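(* Let $J$ be a spin factor with open unit ball $B$, and let $g=Tg_a$ be a biholomorphic automorphism of $B$, where $T$ is a surjective linear isometry of $J$ and $g_a$ is the transvection generated by $a\in B$. Let $\xi\in\overline{B}$ be a weak fixed point of $g$; that is, there are scalars $\alpha_k\in(0,1)$ with $\alpha_k\nearrow 1$ and points $z_k\in B$ with $z_k=\alpha_k g(z_k)$ for all $k$, such that $z_k\to\xi$ weakly (and hence $g(z_k)\to \xi$ weakly). If any of the following conditions holds, then $\xi$ is a fixed point of $g$, i.e. $g(\xi)=\xi$: (i) $\|\xi\|=1$; or (ii) $\xi=0$ and $a$ is not a non-zero scalar multiple of a maximal tripotent; or (iii) $\xi=0$ and $\|z_k\|\not\to 1$; or (iv) each $z_k$ is rank one.
   Context: A spin factor $J$ is a complex Hilbert space with inner product $\langle\cdot,\cdot\rangle$ (linear in the first variable), equipped with a conjugation $j:J\to J$ ($j$ is conjugate linear, $\langle jx,jy\rangle=\overline{\langle x,y\rangle}$, $j^2=I$), given the equivalent norm $\|x\|^2=\langle x,x\rangle+\sqrt{\langle x,x\rangle^2-|\langle x,jx\rangle|^2}$ and the triple product $\{a,b,c\}=\langle a,b\rangle c+\langle c,b\rangle a-\langle a,jc\rangle jb$. Balls, norms and isometries refer to $\|\cdot\|$. A tripotent is a non-zero $e\in J$ with $\{e,e,e\}=e$. Every tripotent of $J$ is of one of two kinds: minimal, i.e. $\langle e,je\rangle=0$ and $\langle e,e\rangle=\frac12$; or maximal, i.e. $je=\lambda e$ with $|\lambda|=1$ and $\langle e,e\rangle=1$.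 An element is rank one if it is a non-zero scalar multiple of a minimal tripotent. For $x,y\in J$ let $D(x,y)z=\{x,y,z\}$, $Q_xz=\{x,z,x\}$ and $B(x,y)=I-2D(x,y)+Q_xQ_y$. For $a\in B$, $B_a$ denotes the unique square root of $B(a,a)$ with positive spectrum, and the transvection is $g_a(x)=a+B_a x^{-a}$, where $x^{-a}=(I+D(x,a))^{-1}x$. Every biholomorphic automorphism $g$ of $B$ can be written uniquely as $g=Tg_a$ with $T$ a surjective linear isometry of $J$ and $a\in B$; it is defined and continuous on the ball of radius $\|a\|^{-1}$ (on all of $J$ if $a=0$), in particular on $\overline{B}$. *)

theory Defs
  imports "HOL-Analysis.Analysis"
begin

text \<open>
  Complex inner product spaces, with inner product linear in the first variable. The ambient
  \<open>norm\<close>, \<open>dist\<close> and \<open>open\<close> of the type are those of the inner product; positive definiteness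
  is inherited from \<open>real_inner\<close> through \<open>inner_eq_Re_cinner\<close>.
\<close>

class complex_inner = real_inner +
  fixes scaleC :: "complex \<Rightarrow> 'a \<Rightarrow> 'a" (infixr \<open>*\<^sub>C\<close> 75)
    and cinner :: "'a \<Rightarrow> 'a \<Rightarrow> complex"
  assumes scaleC_add_right: "c *\<^sub>C (x + y) = c *\<^sub>C x + c *\<^sub>C y"
    and scaleC_add_left: "(c + d) *\<^sub>C x = c *\<^sub>C x + d *\<^sub>C x"
    and scaleC_scaleC: "c *\<^sub>C (d *\<^sub>C x) = (c * d) *\<^sub>C x"
    and scaleR_scaleC: "r *\<^sub>R x = complex_of_real r *\<^sub>C x"
    and cinner_commute: "cinner x y = cnj (cinner y x)"
    and cinner_add_left: "cinner (x + y) z = cinner x z + cinner y z"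
    and cinner_scaleC_left: "cinner (c *\<^sub>C x) y = c * cinner x y"
    and inner_eq_Re_cinner: "inner x y = Re (cinner x y)"

instantiation complex :: complex_inner
begin

definition scaleC_complex :: "complex \<Rightarrow> complex \<Rightarrow> complex"
  where "scaleC_complex c x = c * x"

definition cinner_complex :: "complex \<Rightarrow> complex \<Rightarrow> complex"
  where "cinner_complex x y = x * cnj y"

instance
  by standard
    (auto simp: scaleC_complex_def cinner_complex_def algebra_simps scaleR_conv_of_real
      inner_complex_def)

end

definition clinear :: "('a::complex_inner \<Rightarrow> 'b::complex_inner) \<Rightarrow> bool"
  where "clinear f \<longleftrightarrow> Vector_Spaces.linear (*\<^sub>C) (*\<^sub>C) f"

definition bounded_clinear :: "('a::complex_inner \<Rightarrow> 'b::complex_inner) \<Rightarrow> bool"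
  where "bounded_clinear f \<longleftrightarrow> clinear f \<and> bounded_linear f"

definition weakly_tendsto :: "(nat \<Rightarrow> 'a::complex_inner) \<Rightarrow> 'a \<Rightarrow> bool"
  where "weakly_tendsto z \<xi> \<longleftrightarrow>
    (\<forall>f :: 'a \<Rightarrow> complex. bounded_clinear f \<longrightarrow> (\<lambda>k. f (z k)) \<longlonglongrightarrow> f \<xi>)"

definition op_spectrum :: "('a::complex_inner \<Rightarrow> 'a) \<Rightarrow> complex set"
  where "op_spectrum S =
    {\<mu>. \<not> (bij (\<lambda>x. S x - \<mu> *\<^sub>C x) \<and> bounded_clinear (inv (\<lambda>x. S x - \<mu> *\<^sub>C x)))}"

text \<open>Holomorphy between open sets is complex Frechet differentiability.\<close>

definition holomorphic_map_on ::
    "('a::complex_inner \<Rightarrow> 'b::complex_inner) \<Rightarrow> 'a set \<Rightarrow> bool"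
  where "holomorphic_map_on f U \<longleftrightarrow>
    (\<forall>x\<in>U. \<exists>f'. clinear f' \<and> (f has_derivative f') (at x))"

definition biholomorphic_automorphism :: "'a::complex_inner set \<Rightarrow> ('a \<Rightarrow> 'a) \<Rightarrow> bool"
  where "biholomorphic_automorphism U g \<longleftrightarrow>
    bij_betw g U U \<and> holomorphic_map_on g U \<and> holomorphic_map_on (the_inv_into U g) U"

class spin_factor = complex_inner + complete_space +
  fixes conjn :: "'a \<Rightarrow> 'a"
  assumes conjn_add: "conjn (x + y) = conjn x + conjn y"
    and conjn_scaleC: "conjn (c *\<^sub>C x) = cnj c *\<^sub>C conjn x"
    and cinner_conjn_conjn: "cinner (conjn x) (conjn y) = cnj (cinner x y)"
    and conjn_conjn: "conjn (conjn x) = x"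

text \<open>
  The norm of the spin factor, as opposed to \<open>norm\<close>, which is the equivalent Hilbert space norm.
  Topological notions (closure, boundedness of operators, derivatives, weak convergence) are the
  same for both; balls and isometries refer to \<open>spin_norm\<close>.
\<close>

definition spin_norm :: "'a::spin_factor \<Rightarrow> real"
  where "spin_norm x =
    sqrt (Re (cinner x x) + sqrt ((Re (cinner x x))\<^sup>2 - (cmod (cinner x (conjn x)))\<^sup>2))"

definition spin_ball :: "'a::spin_factor set"
  where "spin_ball = {x. spin_norm x < 1}"

definition triple :: "'a::spin_factor \<Rightarrow> 'a \<Rightarrow> 'a \<Rightarrow> 'a"
  where "triple a b c =
    cinner a b *\<^sub>C c + cinner c b *\<^sub>C a - cinner a (conjn c) *\<^sub>C conjn b"

definition tripotent :: "'a::spin_factor \<Rightarrow> bool"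
  where "tripotent e \<longleftrightarrow> e \<noteq> 0 \<and> triple e e e = e"

definition minimal_tripotent :: "'a::spin_factor \<Rightarrow> bool"
  where "minimal_tripotent e \<longleftrightarrow>
    tripotent e \<and> cinner e (conjn e) = 0 \<and> cinner e e = 1 / 2"

definition maximal_tripotent :: "'a::spin_factor \<Rightarrow> bool"
  where "maximal_tripotent e \<longleftrightarrow>
    tripotent e \<and> (\<exists>\<mu>. cmod \<mu> = 1 \<and> conjn e = \<mu> *\<^sub>C e) \<and> cinner e e = 1"

definition rank_one :: "'a::spin_factor \<Rightarrow> bool"
  where "rank_one x \<longleftrightarrow> (\<exists>c e. c \<noteq> 0 \<and> minimal_tripotent e \<and> x = c *\<^sub>C e)"

definition D_op :: "'a::spin_factor \<Rightarrow> 'a \<Rightarrow> 'a \<Rightarrow> 'a"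
  where "D_op x y z = triple x y z"

definition Q_op :: "'a::spin_factor \<Rightarrow> 'a \<Rightarrow> 'a"
  where "Q_op x z = triple x z x"

definition bergman :: "'a::spin_factor \<Rightarrow> 'a \<Rightarrow> 'a \<Rightarrow> 'a"
  where "bergman x y z = z - 2 *\<^sub>C D_op x y z + Q_op x (Q_op y z)"

definition bergman_root :: "'a::spin_factor \<Rightarrow> 'a \<Rightarrow> 'a"
  where "bergman_root a =
    (THE S. bounded_clinear S \<and> S \<circ> S = bergman a a \<and>
            op_spectrum S \<subseteq> complex_of_real ` {0<..})"

text \<open>
  The quasi-inverse \<open>x\<^sup>-\<^sup>a\<close>. It is meaningful where \<open>I + D(x, a)\<close> is invertible, in particular
  if \<open>spin_norm x * spin_norm a < 1\<close>.
\<close>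

definition quasi_inverse :: "'a::spin_factor \<Rightarrow> 'a \<Rightarrow> 'a"
  where "quasi_inverse x a = inv (\<lambda>z. z + D_op x a z) x"

definition transvection :: "'a::spin_factor \<Rightarrow> 'a \<Rightarrow> 'a"
  where "transvection a x = a + bergman_root a (quasi_inverse x a)"

definition surj_linear_isometry :: "('a::spin_factor \<Rightarrow> 'a) \<Rightarrow> bool"
  where "surj_linear_isometry T \<longleftrightarrow>
    clinear T \<and> surj T \<and> (\<forall>x. spin_norm (T x) = spin_norm x)"

end

theory Submission
  imports Defs
begin

text \<open>
  Write \<open>q x = \<langle>x, j x\<rangle>\<close>. In a spin factor the transvection is fractional linear in \<open>(x, q x)\<close>: with
  \<open>\<delta> x = 1 + 2\<langle>x, a\<rangle> + q x \<cdot> cnj (q a)\<close> one has \<open>g\<^sub>a x = a + B\<^sub>a ((x + q x \<cdot> j a) / \<delta> x)\<close>. Hence if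
  \<open>q (z\<^sub>k)\<close> converges to \<open>\<beta>\<close>, possibly along a subsequence, then \<open>\<xi> = T (a + B\<^sub>a ((\<xi> + \<beta> j a) / \<delta>))\<close>
  with \<open>\<delta> = 1 + 2\<langle>\<xi>, a\<rangle> + \<beta> \<cdot> cnj (q a)\<close>, and \<open>\<xi>\<close> is fixed by \<open>g\<close> once \<open>\<beta> = q \<xi>\<close>.

  If \<open>\<xi>\<close> has norm one, then \<open>z\<^sub>k\<close> converges in norm. If \<open>\<xi> = 0\<close>, the equation reduces to
  \<open>a = - \<beta> j a\<close>, so for \<open>a \<noteq> 0\<close> it forces \<open>\<bar>\<beta>\<bar> = 1\<close>, \<open>a\<close> is a multiple of a maximal tripotent and
  \<open>\<parallel>z\<^sub>k\<parallel>\<close> tends to one. If all \<open>z\<^sub>k\<close> have rank one, that is \<open>q (z\<^sub>k) = 0\<close>, apply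
  \<open>q (g\<^sub>a x - g\<^sub>a y) = \<Delta> a \<cdot> q (x - y) / (\<delta> x \<cdot> \<delta> y)\<close>, where \<open>\<Delta> a = 1 - 2\<langle>a, a\<rangle> + \<bar>q a\<bar>\<^sup>2\<close>, to
  \<open>z\<^sub>k\<close> and \<open>z\<^sub>l\<close>: as isometries preserve \<open>\<bar>q\<bar>\<close>, either \<open>\<langle>z\<^sub>k, j z\<^sub>l\<rangle> = 0\<close> or
  \<open>\<bar>\<delta> z\<^sub>k\<bar> \<bar>\<delta> z\<^sub>l\<bar> = \<alpha>\<^sub>k \<alpha>\<^sub>l \<Delta> a < \<Delta> a\<close>. The latter contradicts \<open>\<bar>\<delta> z\<^sub>k\<bar>\<^sup>2 \<ge> \<Delta> a\<close>, which follows from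
  \<open>\<Delta> (g\<^sub>a x) \<bar>\<delta> x\<bar>\<^sup>2 = \<Delta> a \<Delta> x\<close>; so \<open>q \<xi> = 0\<close>.
\<close>

section \<open>Complex inner product spaces\<close>

text \<open>The class has no axiom for the unit scalar; it comes from the compatibility with real
  scalars at \<open>1\<close>.\<close>

lemma vector_space_scaleC: "vector_space ((*\<^sub>C) :: complex \<Rightarrow> 'a::complex_inner \<Rightarrow> 'a)"
proof
  show "1 *\<^sub>C x = x" for x :: 'a
    using scaleR_scaleC[of 1 x] by simp
qed (simp_all add: scaleC_add_right scaleC_add_left scaleC_scaleC)

interpretation scaleC: vector_space "(*\<^sub>C) :: complex \<Rightarrow> 'a::complex_inner \<Rightarrow> 'a"
  by (rule vector_space_scaleC)

declare scaleC.scale_one [simp] scaleC.scale_zero_left [simp] scaleC.scale_zero_right [simp]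

lemma clinear_iff:
  "clinear f \<longleftrightarrow> (\<forall>x y. f (x + y) = f x + f y) \<and> (\<forall>c x. f (c *\<^sub>C x) = c *\<^sub>C f x)"
  unfolding clinear_def Vector_Spaces.linear_def module_hom_def module_hom_axioms_def
  by (auto simp: vector_space_scaleC scaleC.module_axioms)

lemma clinearI:
  assumes "\<And>x y. f (x + y) = f x + f y" "\<And>c x. f (c *\<^sub>C x) = c *\<^sub>C f x"
  shows "clinear f"
  using assms by (simp add: clinear_iff)

lemma clinear_add: "clinear f \<Longrightarrow> f (x + y) = f x + f y"
  and clinear_scaleC: "clinear f \<Longrightarrow> f (c *\<^sub>C x) = c *\<^sub>C f x"
  by (simp_all add: clinear_iff)

lemma clinear_zero: "clinear f \<Longrightarrow> f 0 = 0"
  using clinear_scaleC[of f 0 0] by simp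

lemma clinear_uminus: "clinear f \<Longrightarrow> f (- x) = - f x"
  using clinear_scaleC[of f "-1" x] by simp

lemma clinear_diff: "clinear f \<Longrightarrow> f (x - y) = f x - f y"
  using clinear_add[of f x "- y"] by (simp add: clinear_uminus)

lemma scaleC_complex [simp]: "c *\<^sub>C (d :: complex) = c * d"
  by (simp add: scaleC_complex_def)

lemma cinner_zero_left [simp]: "cinner 0 x = 0"
  using cinner_scaleC_left[of 0 0 x] by simp

lemma cinner_zero_right [simp]: "cinner x 0 = 0"
  by (simp add: cinner_commute[of x 0])

lemma cinner_add_right: "cinner x (y + z) = cinner x y + cinner x z"
  by (metis cinner_add_left cinner_commute complex_cnj_add)

lemma cinner_scaleC_right: "cinner x (c *\<^sub>C y) = cnj c * cinner x y"
  by (metis cinner_scaleC_left cinner_commute complex_cnj_mult)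

lemma cinner_minus_left: "cinner (- x) y = - cinner x y"
  using cinner_scaleC_left[of "-1" x y] by simp

lemma cinner_minus_right: "cinner x (- y) = - cinner x y"
  using cinner_scaleC_right[of x "-1" y] by simp

lemma cinner_diff_left: "cinner (x - y) z = cinner x z - cinner y z"
  using cinner_add_left[of x "- y" z] by (simp add: cinner_minus_left)

lemma cinner_diff_right: "cinner x (y - z) = cinner x y - cinner x z"
  using cinner_add_right[of x y "- z"] by (simp add: cinner_minus_right)

lemma cinner_scaleR_left: "cinner (r *\<^sub>R x) y = of_real r * cinner x y"
  by (simp add: scaleR_scaleC cinner_scaleC_left)

lemma cinner_scaleR_right: "cinner x (r *\<^sub>R y) = of_real r * cinner x y"
  by (simp add: scaleR_scaleC cinner_scaleC_right)

lemmas cinner_simps =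
  cinner_add_left cinner_add_right cinner_diff_left cinner_diff_right cinner_minus_left
  cinner_minus_right cinner_scaleC_left cinner_scaleC_right cinner_scaleR_left
  cinner_scaleR_right

lemma cinner_same: "cinner x x = of_real ((norm x)\<^sup>2)"
proof (rule complex_eqI)
  show "Re (cinner x x) = Re (of_real ((norm x)\<^sup>2))"
    using inner_eq_Re_cinner[of x x] by (simp add: power2_norm_eq_inner)
  show "Im (cinner x x) = Im (of_real ((norm x)\<^sup>2))"
    using arg_cong[OF cinner_commute[of x x], of Im] by simp
qed

text \<open>Vector identities below are proved by pairing with an arbitrary \<open>w\<close>, which
  turns them into identities between complex numbers.\<close>

lemma cinner_ext:
  assumes "\<And>w. cinner x w = cinner y w"
  shows "x = y"
proof -
  have "cinner (x - y) (x - y) = 0"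
    using assms by (simp add: cinner_diff_left)
  then show ?thesis
    by (simp add: cinner_same)
qed

lemma norm_scaleC: "norm (c *\<^sub>C (x :: 'a::complex_inner)) = cmod c * norm x"
proof -
  have "cinner (c *\<^sub>C x) (c *\<^sub>C x) = (c * cnj c) * cinner x x"
    by (simp add: cinner_scaleC_left cinner_scaleC_right)
  then have "complex_of_real ((norm (c *\<^sub>C x))\<^sup>2) = of_real ((cmod c * norm x)\<^sup>2)"
    by (simp only: cinner_same complex_norm_square[symmetric] power_mult_distrib of_real_mult)
  then have "(norm (c *\<^sub>C x))\<^sup>2 = (cmod c * norm x)\<^sup>2"
    using of_real_eq_iff by blast
  then show ?thesis
    by (simp add: power2_eq_iff_nonneg)
qed

lemma cinner_Cauchy_Schwarz: "cmod (cinner x y) \<le> norm x * norm y"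
proof (cases "cinner x y = 0")
  case False
  \<comment> \<open>Multiplying \<open>x\<close> by this phase makes the inner product real and
    nonnegative, so the real Cauchy-Schwarz inequality applies.\<close>
  define c where "c = cnj (sgn (cinner x y))"
  have c: "cmod c = 1" "c * cinner x y = of_real (cmod (cinner x y))"
    using False by (simp_all add: c_def norm_sgn)
      (simp add: sgn_div_norm complex_norm_square[symmetric] scaleR_conv_of_real
        field_simps power2_eq_square flip: complex_norm_square)
  have "cmod (cinner x y) = inner (c *\<^sub>C x) y"
    by (simp add: inner_eq_Re_cinner cinner_scaleC_left c)
  also have "\<dots> \<le> norm (c *\<^sub>C x) * norm y"
    by (rule norm_cauchy_schwarz)
  finally show ?thesis
    by (simp add: norm_scaleC c)
qed simp

lemma bounded_clinearI:
  assumes "clinear f" "\<And>x. norm (f x) \<le> K * norm x"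
  shows "bounded_clinear f"
  unfolding bounded_clinear_def
proof (intro conjI assms(1) bounded_linear_intro)
  show "f (r *\<^sub>R x) = r *\<^sub>R f x" for r x
    by (simp add: scaleR_scaleC clinear_scaleC[OF assms(1)])
qed (use assms in \<open>auto simp: clinear_add mult.commute\<close>)

lemma bounded_clinear_imp_clinear: "bounded_clinear f \<Longrightarrow> clinear f"
  by (simp add: bounded_clinear_def)

lemma bounded_clinear_compose:
  "bounded_clinear f \<Longrightarrow> bounded_clinear g \<Longrightarrow> bounded_clinear (\<lambda>x. f (g x))"
  by (auto simp: bounded_clinear_def clinear_iff intro: bounded_linear_compose)

lemma bounded_clinear_add:
  "bounded_clinear f \<Longrightarrow> bounded_clinear g \<Longrightarrow> bounded_clinear (\<lambda>x. f x + g x)"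
  by (auto simp: bounded_clinear_def clinear_iff scaleC_add_right intro: bounded_linear_add)

lemma bounded_clinear_id: "bounded_clinear (\<lambda>x. x)"
  by (simp add: bounded_clinear_def clinear_iff)

lemma bounded_clinear_scaleC_const:
  assumes "bounded_clinear f"
  shows "bounded_clinear (\<lambda>x. c *\<^sub>C f x)"
proof -
  have "bounded_clinear (\<lambda>x :: 'b. c *\<^sub>C x)"
    by (rule bounded_clinearI[where K = "cmod c"])
      (auto simp: clinear_iff scaleC_add_right scaleC_scaleC mult.commute norm_scaleC)
  from bounded_clinear_compose[OF this assms] show ?thesis .
qed

lemma bounded_clinear_cinner_scaleC: "bounded_clinear (\<lambda>x. cinner x y *\<^sub>C v)"
  by (rule bounded_clinearI[where K = "norm y * norm v"])
    (use mult_right_mono[OF cinner_Cauchy_Schwarz, of "norm v"] in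
      \<open>auto simp: clinear_iff cinner_simps scaleC_add_left scaleC_scaleC norm_scaleC ac_simps\<close>)

lemma bounded_clinear_cinner: "bounded_clinear (\<lambda>x. cinner x y)"
  by (rule bounded_clinearI[where K = "norm y"])
    (use cinner_Cauchy_Schwarz in \<open>auto simp: clinear_iff cinner_simps ac_simps\<close>)

lemma weakly_tendsto_cinner: "weakly_tendsto z \<xi> \<Longrightarrow> (\<lambda>k. cinner (z k) y) \<longlonglongrightarrow> cinner \<xi> y"
  using bounded_clinear_cinner by (auto simp: weakly_tendsto_def)

section \<open>Spin factors\<close>

lemma cinner_conjn_right: "cinner x (conjn y) = cinner y (conjn x)"
  by (metis cinner_commute cinner_conjn_conjn conjn_conjn)

lemma cinner_conjn_conjn': "cinner (conjn x) (conjn y) = cinner y x"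
  by (metis cinner_commute cinner_conjn_conjn)

lemma cinner_conjn_left: "cinner (conjn x) y = cnj (cinner x (conjn y))"
  by (metis cinner_conjn_conjn conjn_conjn)

lemma conjn_zero [simp]: "conjn 0 = 0"
  using conjn_scaleC[of 0 0] by simp

lemma conjn_minus: "conjn (- x) = - conjn x"
  using conjn_scaleC[of "-1" x] by simp

lemma conjn_diff: "conjn (x - y) = conjn x - conjn y"
  using conjn_add[of x "- y"] by (simp add: conjn_minus)

lemma conjn_scaleR: "conjn (r *\<^sub>R x) = r *\<^sub>R conjn x"
  by (simp add: scaleR_scaleC conjn_scaleC)

lemmas conjn_simps = conjn_add conjn_diff conjn_minus conjn_scaleC conjn_scaleR conjn_conjn

lemma norm_conjn: "norm (conjn x) = norm x"
proof -
  have "complex_of_real ((norm (conjn x))\<^sup>2) = of_real ((norm x)\<^sup>2)"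
    unfolding cinner_same[symmetric] by (rule cinner_conjn_conjn')
  then have "(norm (conjn x))\<^sup>2 = (norm x)\<^sup>2"
    using of_real_eq_iff by blast
  then show ?thesis
    by (simp add: power2_eq_iff_nonneg)
qed

section \<open>The quadratic form, the determinant and the unit ball\<close>

definition quad :: "'a::spin_factor \<Rightarrow> complex"
  where "quad x = cinner x (conjn x)"

text \<open>Let s^2 and t^2 be \<open>(norm x)\<^sup>2\<close> plus and minus the inner root in
  \<open>spin_norm x\<close>, so that s is \<open>spin_norm x\<close>. Then this is (1 - s^2)(1 -
  t^2).\<close>

definition spin_det :: "'a::spin_factor \<Rightarrow> real"
  where "spin_det x = 1 - 2 * (norm x)\<^sup>2 + (cmod (quad x))\<^sup>2"

lemma quad_scaleC: "quad (c *\<^sub>C x) = c\<^sup>2 * quad x"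
  by (simp add: quad_def conjn_simps cinner_simps power2_eq_square)

lemma quad_conjn: "quad (conjn x) = cnj (quad x)"
  by (simp add: quad_def conjn_conjn cinner_commute[of "conjn x"])

lemma quad_add: "quad (x + y) = quad x + 2 * cinner x (conjn y) + quad y"
  by (simp add: quad_def conjn_simps cinner_simps cinner_conjn_right[of y x])

lemma quad_diff: "quad (x - y) = quad x - 2 * cinner x (conjn y) + quad y"
  by (simp add: quad_def conjn_simps cinner_simps cinner_conjn_right[of y x])

lemma quad_le: "cmod (quad x) \<le> (norm x)\<^sup>2"
  using cinner_Cauchy_Schwarz[of x "conjn x"] by (simp add: quad_def norm_conjn power2_eq_square)

lemma quad_sqr_le: "(cmod (quad x))\<^sup>2 \<le> ((norm x)\<^sup>2)\<^sup>2"
  using quad_le power_mono norm_ge_zero by blast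

lemma spin_norm_alt:
  "spin_norm x = sqrt ((norm x)\<^sup>2 + sqrt (((norm x)\<^sup>2)\<^sup>2 - (cmod (quad x))\<^sup>2))"
  by (simp add: spin_norm_def cinner_same quad_def)

text \<open>Polynomial conditions replace the nested roots. The sign of the determinant alone does
  not suffice: \<open>norm x \<le> 1\<close> excludes that both of its factors are negative.\<close>

lemma spin_norm_le_1_iff: "spin_norm x \<le> 1 \<longleftrightarrow> norm x \<le> 1 \<and> 0 \<le> spin_det x"
proof -
  have "spin_norm x \<le> 1 \<longleftrightarrow> sqrt (((norm x)\<^sup>2)\<^sup>2 - (cmod (quad x))\<^sup>2) \<le> 1 - (norm x)\<^sup>2"
    by (auto simp: spin_norm_alt)
  also have "\<dots> \<longleftrightarrow> (norm x)\<^sup>2 \<le> 1 \<and> ((norm x)\<^sup>2)\<^sup>2 - (cmod (quad x))\<^sup>2 \<le> (1 - (norm x)\<^sup>2)\<^sup>2"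
    using quad_sqr_le[of x] by (smt (verit) real_sqrt_ge_zero real_le_lsqrt real_sqrt_le_iff real_sqrt_abs sqrt_le_D)
  also have "\<dots> \<longleftrightarrow> norm x \<le> 1 \<and> 0 \<le> spin_det x"
    by (auto simp: spin_det_def power2_eq_square algebra_simps abs_square_le_1[unfolded power2_eq_square])
  finally show ?thesis .
qed

lemma spin_norm_less_1_iff: "spin_norm x < 1 \<longleftrightarrow> norm x < 1 \<and> 0 < spin_det x"
proof -
  have "spin_norm x < 1 \<longleftrightarrow> sqrt (((norm x)\<^sup>2)\<^sup>2 - (cmod (quad x))\<^sup>2) < 1 - (norm x)\<^sup>2"
    by (auto simp: spin_norm_alt)
  also have "\<dots> \<longleftrightarrow> (norm x)\<^sup>2 < 1 \<and> ((norm x)\<^sup>2)\<^sup>2 - (cmod (quad x))\<^sup>2 < (1 - (norm x)\<^sup>2)\<^sup>2"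
    using quad_sqr_le[of x] by (smt (verit) real_sqrt_ge_zero real_less_lsqrt real_sqrt_less_iff real_sqrt_abs)
  also have "\<dots> \<longleftrightarrow> norm x < 1 \<and> 0 < spin_det x"
    by (auto simp: spin_det_def power2_eq_square algebra_simps abs_square_less_1[unfolded power2_eq_square])
  finally show ?thesis .
qed

section \<open>The quasi-inverse and the root of the Bergman operator\<close>

definition qdenom :: "'a::spin_factor \<Rightarrow> 'a \<Rightarrow> complex"
  where "qdenom a x = 1 + 2 * cinner x a + quad x * cnj (quad a)"

lemma clinear_D_op: "clinear (D_op x a)"
  by (rule clinearI; rule cinner_ext)
    (simp_all add: D_op_def triple_def cinner_simps conjn_simps algebra_simps)

text \<open>Pairing a kernel vector \<open>z\<close> of \<open>I + D(x, a)\<close> with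
  \<open>a\<close> and \<open>conjn x\<close> gives a homogeneous linear system for
  \<open>cinner z a\<close> and \<open>cinner z (conjn x)\<close> with determinant
  \<open>qdenom a x\<close>. Both numbers vanish, the operator acts on \<open>z\<close> as the
  scalar \<open>1 + cinner x a\<close>, and this is nonzero by the bound on the norms. Injectivity
  then allows the value of \<open>inv\<close> to be read off from one preimage.\<close>

lemma quasi_inverse_eq:
  assumes "qdenom a x \<noteq> 0" "norm x * norm a < 1"
  shows "quasi_inverse x a = inverse (qdenom a x) *\<^sub>C (x + quad x *\<^sub>C conjn a)"
proof -
  let ?f = "\<lambda>z. z + D_op x a z"
  let ?w = "inverse (qdenom a x) *\<^sub>C (x + quad x *\<^sub>C conjn a)"
  have f_inner: "cinner (?f z) w =
      (1 + cinner x a) * cinner z w + cinner z a * cinner x w - cinner z (conjn x) * cinner (conjn a) w"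
    for z w
    by (simp add: D_op_def triple_def cinner_simps cinner_conjn_right[of x z] algebra_simps)
  have i: "cinner (conjn a) a = cnj (quad a)" "cinner x (conjn x) = quad x"
    "cinner (conjn a) (conjn x) = cinner x a"
    by (simp_all add: quad_def cinner_conjn_left[of a a] cinner_conjn_conjn')
  have "cmod (cinner x a) < 1"
    using cinner_Cauchy_Schwarz[of x a] assms(2) by linarith
  then have nz: "1 + cinner x a \<noteq> 0"
    by (auto simp: add_eq_0_iff)
  have zero: "z = 0" if "?f z = 0" for z
  proof -
    have "cinner (?f z) a = 0" "cinner (?f z) (conjn x) = 0"
      using that by simp_all
    then have eqs: "(1 + 2 * cinner x a) * cinner z a = cinner z (conjn x) * cnj (quad a)"
      "cinner z (conjn x) + cinner z a * quad x = 0"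
      unfolding f_inner i by (simp_all add: quad_def algebra_simps)
    have "cinner z a * qdenom a x = (cinner z (conjn x) + cinner z a * quad x) * cnj (quad a)"
      unfolding qdenom_def using eqs(1) by (simp add: algebra_simps)
    with assms(1) eqs have "cinner z a = 0" "cinner z (conjn x) = 0"
      by simp_all
    then have "(1 + cinner x a) * cinner z z = 0"
      using f_inner[of z z] that by simp
    with nz show ?thesis
      by (simp add: cinner_same)
  qed
  have "inj ?f"
  proof (rule injI)
    fix y z assume "?f y = ?f z"
    then have "?f (y - z) = 0"
      by (simp add: clinear_diff[OF clinear_D_op] algebra_simps)
    from zero[OF this] show "y = z" by simp
  qed
  moreover have "?f ?w = x"
  proof (rule cinner_ext)
    fix w
    have "cinner (?f ?w) w = inverse (qdenom a x) * qdenom a x * cinner x w"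
      unfolding f_inner unfolding cinner_simps i qdenom_def by (simp only: algebra_simps) simp
    with assms(1) show "cinner (?f ?w) w = cinner x w"
      by simp
  qed
  ultimately show ?thesis
    unfolding quasi_inverse_def using inv_f_f[of ?f ?w] by simp
qed

text \<open>
  With \<open>D = sqrt (spin_det a)\<close>, the square root of \<open>B(a,a)\<close> is \<open>I - D(a,a)\<close> on the span of \<open>a\<close>
  and \<open>conjn a\<close> and \<open>D\<close> times the identity on the orthogonal complement. The Gram determinant of
  \<open>a\<close> and \<open>conjn a\<close> cancels from the projection onto the span, which makes the resulting formula
  valid also if \<open>a\<close> and \<open>conjn a\<close> are linearly dependent.
\<close>

definition broot :: "'a::spin_factor \<Rightarrow> 'a \<Rightarrow> 'a"
  where "broot a z =
    (let D = sqrt (spin_det a); h = (norm a)\<^sup>2; c = inverse (1 - h + D) in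
      of_real D *\<^sub>C z
      - (of_real c * (of_real (1 - 2 * h + D) * cinner z a + cnj (quad a) * cinner z (conjn a))) *\<^sub>C a
      + (of_real c * (of_real (1 + D) * cinner z (conjn a) - quad a * cinner z a)) *\<^sub>C conjn a)"

lemma bounded_clinear_broot: "bounded_clinear (broot a)"
proof -
  define D where "D = sqrt (spin_det a)"
  define h where "h = (norm a)\<^sup>2"
  define c where "c = inverse (1 - h + D)"
  have "broot a = (\<lambda>z. of_real D *\<^sub>C z
      + (- of_real c * of_real (1 - 2 * h + D)) *\<^sub>C (cinner z a *\<^sub>C a)
      + (- of_real c * cnj (quad a)) *\<^sub>C (cinner z (conjn a) *\<^sub>C a)
      + (of_real c * of_real (1 + D)) *\<^sub>C (cinner z (conjn a) *\<^sub>C conjn a)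
      + (- of_real c * quad a) *\<^sub>C (cinner z a *\<^sub>C conjn a))"
    unfolding broot_def Let_def D_def[symmetric] h_def[symmetric] c_def[symmetric]
    by (rule ext, rule cinner_ext) (simp add: cinner_simps algebra_simps)
  moreover have "bounded_clinear \<dots>"
    by (rule bounded_clinear_add bounded_clinear_scaleC_const bounded_clinear_cinner_scaleC
        bounded_clinear_id)+
  ultimately show ?thesis
    by simp
qed

lemma clinear_broot: "clinear (broot a)"
  by (intro bounded_clinear_imp_clinear bounded_clinear_broot)

context
  fixes a :: "'a::spin_factor"
  assumes a: "a \<in> spin_ball"
begin

lemma spin_det_pos: "0 < spin_det a" and norm_less_1: "norm a < 1"
  using a by (auto simp: spin_ball_def spin_norm_less_1_iff)

text \<open>Root, squared norm and inverse become abstract complex numbers tied by polynomial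
  relations, so that the identities for \<open>broot\<close> reduce to commutative algebra.\<close>

lemma broot_params:
  obtains D h c where "D = complex_of_real (sqrt (spin_det a))" "h = of_real ((norm a)\<^sup>2)"
    "D\<^sup>2 = of_real (spin_det a)"
    "D\<^sup>2 = 1 - 2 * h + quad a * cnj (quad a)" "c * (1 - h + D) = 1"
    "cnj D = D" "cnj h = h" "cnj c = c"
    "\<And>z w. cinner (broot a z) w = D * cinner z w
      - c * ((1 - 2 * h + D) * cinner z a + cnj (quad a) * cinner z (conjn a)) * cinner a w
      + c * ((1 + D) * cinner z (conjn a) - quad a * cinner z a) * cinner (conjn a) w"
proof
  let ?D = "sqrt (spin_det a)" and ?h = "(norm a)\<^sup>2"
  let ?c = "inverse (1 - ?h + ?D)"
  show sq: "(complex_of_real ?D)\<^sup>2 = of_real (spin_det a)"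
    using less_imp_le[OF spin_det_pos] by (simp only: of_real_power[symmetric] real_sqrt_pow2)
  show "(complex_of_real ?D)\<^sup>2 = 1 - 2 * of_real ?h + quad a * cnj (quad a)"
    unfolding sq by (simp only: spin_det_def of_real_add of_real_diff of_real_mult of_real_1 of_real_numeral complex_norm_square)
  have "?h < 1"
    using norm_less_1 by (simp add: abs_square_less_1)
  then have "0 < 1 - ?h + ?D"
    using real_sqrt_gt_zero[OF spin_det_pos] by linarith
  then have "?c * (1 - ?h + ?D) = 1"
    by (intro left_inverse) linarith
  then have "complex_of_real (?c * (1 - ?h + ?D)) = 1"
    by (simp only: of_real_1)
  then show "complex_of_real ?c * (1 - of_real ?h + of_real ?D) = 1"
    by (simp only: of_real_mult of_real_add of_real_diff of_real_1)
  show "cinner (broot a z) w = of_real ?D * cinner z w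
      - of_real ?c * ((1 - 2 * of_real ?h + of_real ?D) * cinner z a + cnj (quad a) * cinner z (conjn a)) * cinner a w
      + of_real ?c * ((1 + of_real ?D) * cinner z (conjn a) - quad a * cinner z a) * cinner (conjn a) w"
    for z w
    by (simp add: broot_def Let_def cinner_simps)
qed simp_all

text \<open>The coefficients of \<open>broot\<close> with respect to \<open>a\<close> and
  \<open>conjn a\<close> form a Hermitian matrix. Self-adjointness later moves
  \<open>broot a\<close> onto \<open>a\<close> and \<open>conjn a\<close>, where its values are
  simple.\<close>

lemma broot_adjoint: "cinner (broot a z) w = cinner z (broot a w)"
proof -
  obtain D h c where p: "cnj D = D" "cnj h = h" "cnj c = c"
    "\<And>z w. cinner (broot a z) w = D * cinner z w
      - c * ((1 - 2 * h + D) * cinner z a + cnj (quad a) * cinner z (conjn a)) * cinner a w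
      + c * ((1 + D) * cinner z (conjn a) - quad a * cinner z a) * cinner (conjn a) w"
    by (rule broot_params) (rule that; assumption)
  have "cinner z (broot a w) = cnj (cinner (broot a w) z)"
    by (rule cinner_commute)
  also have "\<dots> = D * cinner z w
      - c * ((1 - 2 * h + D) * cinner a w + quad a * cinner (conjn a) w) * cinner z a
      + c * ((1 + D) * cinner (conjn a) w - cnj (quad a) * cinner a w) * cinner z (conjn a)"
    unfolding p(4) by (simp add: p(1-3) flip: cinner_commute)
  also have "\<dots> = cinner (broot a z) w"
    unfolding p(4) by (simp add: algebra_simps)
  finally show ?thesis by simp
qed

lemma broot_self: "broot a a = (1 - 2 * of_real ((norm a)\<^sup>2)) *\<^sub>C a + quad a *\<^sub>C conjn a"
  and broot_conjn: "broot a (conjn a) = conjn a - cnj (quad a) *\<^sub>C a"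
proof -
  obtain D h c where p: "h = of_real ((norm a)\<^sup>2)" "D\<^sup>2 = 1 - 2 * h + quad a * cnj (quad a)" "c * (1 - h + D) = 1"
    "\<And>z w. cinner (broot a z) w = D * cinner z w
      - c * ((1 - 2 * h + D) * cinner z a + cnj (quad a) * cinner z (conjn a)) * cinner a w
      + c * ((1 + D) * cinner z (conjn a) - quad a * cinner z a) * cinner (conjn a) w"
    by (rule broot_params) (rule that; assumption)
  have i: "cinner a a = h" "cinner (conjn a) (conjn a) = h" "cinner a (conjn a) = quad a"
    "cinner (conjn a) a = cnj (quad a)"
    using p(1) by (simp_all add: cinner_same norm_conjn quad_def cinner_conjn_left)
  show "broot a a = (1 - 2 * of_real ((norm a)\<^sup>2)) *\<^sub>C a + quad a *\<^sub>C conjn a"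
    "broot a (conjn a) = conjn a - cnj (quad a) *\<^sub>C a"
    unfolding p(1)[symmetric]
    by (rule cinner_ext, simp only: p(4) cinner_simps i, use p(2,3) in algebra)+
qed

lemma broot_broot: "broot a (broot a z) = bergman a a z"
proof (rule cinner_ext)
  fix w
  obtain D h c where p: "h = of_real ((norm a)\<^sup>2)" "D\<^sup>2 = 1 - 2 * h + quad a * cnj (quad a)" "c * (1 - h + D) = 1"
    "cnj h = h"
    "\<And>z w. cinner (broot a z) w = D * cinner z w
      - c * ((1 - 2 * h + D) * cinner z a + cnj (quad a) * cinner z (conjn a)) * cinner a w
      + c * ((1 + D) * cinner z (conjn a) - quad a * cinner z a) * cinner (conjn a) w"
    by (rule broot_params) (rule that; assumption)
  have i: "cinner a a = h" "cinner (conjn a) (conjn a) = h" "cinner a (conjn a) = quad a"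
    "cinner (conjn a) a = cnj (quad a)"
    using p(1) by (simp_all add: cinner_same norm_conjn quad_def cinner_conjn_left)
  have 1: "cinner (bergman a a z) w = cinner z w
     - 2 * (h * cinner z w + cinner z a * cinner a w - cinner z (conjn a) * cinner (conjn a) w)
     + (2 * (2 * cinner z a * h - cnj (quad a) * cinner z (conjn a)) * cinner a w
        - quad a * (2 * cinner z a * cinner (conjn a) w - cnj (quad a) * cinner z w))"
    by (simp add: bergman_def D_op_def Q_op_def triple_def cinner_simps conjn_simps i p(4)
         cinner_conjn_right[of a z] cinner_commute[of a z] cinner_conjn_left cinner_conjn_conjn' algebra_simps)
  define X where "X = (1 - 2 * h + D) * cinner z a + cnj (quad a) * cinner z (conjn a)"
  define Y where "Y = (1 + D) * cinner z (conjn a) - quad a * cinner z a"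
  have e: "cinner (broot a z) w = D * cinner z w - c * X * cinner a w + c * Y * cinner (conjn a) w"
    for w
    unfolding X_def Y_def by (rule p(5))
  have 2: "cinner (broot a (broot a z)) w
      = D * cinner (broot a z) w - c * X * cinner (broot a a) w + c * Y * cinner (broot a (conjn a)) w"
    using e[of "broot a w"] by (simp only: broot_adjoint)
  \<comment> \<open>Eliminating \<open>quad a * cnj (quad a)\<close> exposes the common factor
    \<open>1 - h + D\<close>, which \<open>c\<close> cancels.\<close>
  have q: "quad a * cnj (quad a) = D\<^sup>2 - 1 + 2 * h"
    using p(2) by simp
  have "(1 - 2 * h + D) * X + cnj (quad a) * Y = ((1 - 2 * h + D)\<^sup>2 - quad a * cnj (quad a)) * cinner z a
      + (1 - 2 * h + D + 1 + D) * cnj (quad a) * cinner z (conjn a)"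
    by (simp add: X_def Y_def power2_eq_square algebra_simps)
  also have "\<dots> = (1 - h + D) * (2 * (1 - 2 * h) * cinner z a + 2 * cnj (quad a) * cinner z (conjn a))"
    unfolding q by (simp add: power2_eq_square algebra_simps)
  finally have 3: "c * ((1 - 2 * h + D) * X + cnj (quad a) * Y)
      = 2 * (1 - 2 * h) * cinner z a + 2 * cnj (quad a) * cinner z (conjn a)"
    using p(3) by (metis mult.assoc mult_1)
  have "(1 + D) * Y - quad a * X = ((1 + D)\<^sup>2 - quad a * cnj (quad a)) * cinner z (conjn a)
      - (1 - 2 * h + D + 1 + D) * quad a * cinner z a"
    by (simp add: X_def Y_def power2_eq_square algebra_simps)
  also have "\<dots> = (1 - h + D) * (2 * cinner z (conjn a) - 2 * quad a * cinner z a)"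
    unfolding q by (simp add: power2_eq_square algebra_simps)
  finally have 4: "c * ((1 + D) * Y - quad a * X) = 2 * cinner z (conjn a) - 2 * quad a * cinner z a"
    using p(3) by (metis mult.assoc mult_1)
  have "cinner (broot a (broot a z)) w = D\<^sup>2 * cinner z w
      - c * ((1 - 2 * h + D) * X + cnj (quad a) * Y) * cinner a w
      + c * ((1 + D) * Y - quad a * X) * cinner (conjn a) w"
    unfolding 2 e[of w] broot_self broot_conjn cinner_simps p(1)[symmetric]
    by (simp add: power2_eq_square algebra_simps)
  also have "\<dots> = cinner (bergman a a z) w"
    unfolding 1 3 4 p(2) by (simp add: algebra_simps)
  finally show "cinner (broot a (broot a z)) w = cinner (bergman a a z) w" .
qed

lemma quad_broot: "quad (broot a z) = of_real (spin_det a) * quad z"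
proof -
  obtain D h c where p: "D = complex_of_real (sqrt (spin_det a))" "h = of_real ((norm a)\<^sup>2)" "D\<^sup>2 = of_real (spin_det a)" "D\<^sup>2 = 1 - 2 * h + quad a * cnj (quad a)" "c * (1 - h + D) = 1"
    "cnj D = D" "cnj h = h" "cnj c = c"
    "\<And>z w. cinner (broot a z) w = D * cinner z w
      - c * ((1 - 2 * h + D) * cinner z a + cnj (quad a) * cinner z (conjn a)) * cinner a w
      + c * ((1 + D) * cinner z (conjn a) - quad a * cinner z a) * cinner (conjn a) w"
    by (rule broot_params) (rule that; assumption)
  have i: "cinner a a = h" "cinner (conjn a) (conjn a) = h" "cinner a (conjn a) = quad a"
    "cinner (conjn a) a = cnj (quad a)"
    using p(2) by (simp_all add: cinner_same norm_conjn quad_def cinner_conjn_left)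
  define q where "q = quad a"
  define q' where "q' = cnj (quad a)"
  define s where "s = cinner z a"
  define r where "r = cinner z (conjn a)"
  define X where "X = (1 - 2 * h + D) * s + q' * r"
  define Y where "Y = (1 + D) * r - q * s"
  have 1: "broot a z = D *\<^sub>C z - (c * X) *\<^sub>C a + (c * Y) *\<^sub>C conjn a"
    by (rule cinner_ext) (simp add: p(9) cinner_simps X_def Y_def q_def q'_def s_def r_def)
  have 2: "quad (D *\<^sub>C z - (c * X) *\<^sub>C a + (c * Y) *\<^sub>C conjn a)
     = D\<^sup>2 * quad z + c\<^sup>2 * (X\<^sup>2 * q + Y\<^sup>2 * q' - 2 * X * Y * h) - 2 * c * D * (X * r - Y * s)"
    unfolding quad_add quad_diff quad_scaleC conjn_simps cinner_simps quad_conjn complex_cnj_cnj i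
    by (simp add: q_def q'_def s_def r_def power_mult_distrib power2_eq_square algebra_simps)
  \<comment> \<open>Of the factor \<open>1 - h + D\<close> found here one \<open>c\<close> is used
    up, and the rest cancels the cross term of \<open>2\<close>; only
    \<open>D\<^sup>2 * quad z\<close> survives.\<close>
  have 3: "X\<^sup>2 * q + Y\<^sup>2 * q' - 2 * X * Y * h = 2 * (1 - h + D) * D * (X * r - Y * s)"
  proof -
    define A where "A = 1 - 2 * h + D"
    define C where "C = 1 + D"
    have "X\<^sup>2 * q + Y\<^sup>2 * q' - (C - A) * (X * Y) = (A * C + q * q') * (X * r - Y * s)"
      unfolding X_def Y_def A_def[symmetric] C_def[symmetric] power2_eq_square
      by (simp add: algebra_simps)
    moreover have "A * C + q * q' = 2 * (1 - h + D) * D"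
      using p(4) by (simp add: A_def C_def q_def q'_def power2_eq_square algebra_simps)
    moreover have "C - A = 2 * h"
      by (simp add: A_def C_def)
    ultimately show ?thesis
      by (metis mult.assoc mult.commute)
  qed
  have "quad (broot a z) = D\<^sup>2 * quad z + c\<^sup>2 * (2 * (1 - h + D) * D * (X * r - Y * s)) - 2 * c * D * (X * r - Y * s)"
    by (simp only: 1 2 3)
  also have "c\<^sup>2 * (2 * (1 - h + D) * D * (X * r - Y * s)) = (c * (1 - h + D)) * (2 * c * D * (X * r - Y * s))"
    by (simp only: power2_eq_square mult_ac)
  finally show ?thesis
    by (simp only: p(3,5)) simp
qed

text \<open>Cayley-Hamilton on the span of \<open>a\<close> and \<open>conjn a\<close>, where
  \<open>broot a\<close> has trace \<open>2 * (1 - h)\<close> and determinant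
  \<open>D\<^sup>2\<close>.\<close>

lemma broot_quadratic:
  assumes "D = complex_of_real (sqrt (spin_det a))" "h = complex_of_real ((norm a)\<^sup>2)"
    and "v = a \<or> v = conjn a"
  shows "cinner (broot a (broot a v)) w = 2 * (1 - h) * cinner (broot a v) w - D\<^sup>2 * cinner v w"
proof -
  obtain D' h' where "D' = complex_of_real (sqrt (spin_det a))" "h' = complex_of_real ((norm a)\<^sup>2)"
    "D'\<^sup>2 = 1 - 2 * h' + quad a * cnj (quad a)"
    by (rule broot_params) (rule that; assumption)
  then have "D\<^sup>2 = 1 - 2 * h + quad a * cnj (quad a)"
    by (simp only: assms(1,2))
  moreover have "broot a a = (1 - 2 * h) *\<^sub>C a + quad a *\<^sub>C conjn a"
    by (simp only: broot_self assms(2))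
  ultimately show ?thesis
    using assms(3) by (auto simp: broot_conjn cinner_simps clinear_diff[OF clinear_broot]
        clinear_add[OF clinear_broot] clinear_scaleC[OF clinear_broot])
      (simp_all add: algebra_simps power2_eq_square)
qed

text \<open>Since \<open>broot a\<close> minus \<open>D\<close> maps into the span of
  \<open>a\<close> and \<open>conjn a\<close>, the quadratic polynomial valid there, multiplied by
  (t - D), annihilates \<open>broot a\<close> everywhere.\<close>

lemma broot_cubic:
  assumes "D = complex_of_real (sqrt (spin_det a))" "h = complex_of_real ((norm a)\<^sup>2)"
  shows "broot a (broot a (broot a z)) + ((D + 2 * (1 - h)) * D) *\<^sub>C broot a z
    = (D + 2 * (1 - h)) *\<^sub>C broot a (broot a z) + D ^ 3 *\<^sub>C z"
proof (rule cinner_ext)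
  fix w
  obtain D' h' c where p: "D' = complex_of_real (sqrt (spin_det a))"
    "\<And>z w. cinner (broot a z) w = D' * cinner z w
      - c * ((1 - 2 * h' + D') * cinner z a + cnj (quad a) * cinner z (conjn a)) * cinner a w
      + c * ((1 + D') * cinner z (conjn a) - quad a * cinner z a) * cinner (conjn a) w"
    by (rule broot_params) (rule that; assumption)
  obtain X Y where e: "\<And>w. cinner (broot a z) w = D * cinner z w - X * cinner a w + Y * cinner (conjn a) w"
    using p(2) unfolding p(1) assms(1)[symmetric] by (rule that)
  have 1: "cinner (broot a z) w = D * cinner z w - X * cinner a w + Y * cinner (conjn a) w"
    by (rule e)
  have 2: "cinner (broot a (broot a z)) w
      = D * cinner (broot a z) w - X * cinner (broot a a) w + Y * cinner (broot a (conjn a)) w"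
    using e[of "broot a w"] by (simp only: broot_adjoint)
  have "cinner (broot a (broot a (broot a z))) w
      = D * cinner (broot a (broot a z)) w - X * cinner (broot a (broot a a)) w
        + Y * cinner (broot a (broot a (conjn a))) w"
    using e[of "broot a (broot a w)"] by (simp only: broot_adjoint)
  also have "\<dots> = D * cinner (broot a (broot a z)) w
      - X * (2 * (1 - h) * cinner (broot a a) w - D\<^sup>2 * cinner a w)
      + Y * (2 * (1 - h) * cinner (broot a (conjn a)) w - D\<^sup>2 * cinner (conjn a) w)"
    by (simp only: broot_quadratic[OF assms disjI1[OF refl]] broot_quadratic[OF assms disjI2[OF refl]])
  finally show "cinner (broot a (broot a (broot a z)) + ((D + 2 * (1 - h)) * D) *\<^sub>C broot a z) w
    = cinner ((D + 2 * (1 - h)) *\<^sub>C broot a (broot a z) + D ^ 3 *\<^sub>C z) w"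
    unfolding cinner_simps using 1 2 by algebra
qed

end

section \<open>Spectrum of the root and uniqueness of the positive square root\<close>

lemma not_in_op_spectrum_cubic:
  assumes S: "bounded_clinear S"
    and cubic: "\<And>x. S (S (S x)) + e2 *\<^sub>C S x = e1 *\<^sub>C S (S x) + e3 *\<^sub>C x"
    and \<mu>: "\<mu> ^ 3 + e2 * \<mu> \<noteq> e1 * \<mu>\<^sup>2 + e3"
  shows "\<mu> \<notin> op_spectrum S"
proof -
  define k where "k = inverse (e1 * \<mu>\<^sup>2 + e3 - (\<mu> ^ 3 + e2 * \<mu>))"
  have k: "k * (e1 * \<mu>\<^sup>2 + e3 - (\<mu> ^ 3 + e2 * \<mu>)) = 1"
    using \<mu> by (simp add: k_def)
  \<comment> \<open>With p(t) = t^3 - e1 t^2 + e2 t - e3, this is (p(t) - p(\<mu>)) / (t - \<mu>)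
    evaluated at \<open>S\<close> and divided by -p(\<mu>). As p(S) = 0, it inverts \<open>S\<close>
    minus \<mu>.\<close>
  define R where "R = (\<lambda>x. k *\<^sub>C S (S x) + (k * (\<mu> - e1)) *\<^sub>C S x + (k * (\<mu>\<^sup>2 - e1 * \<mu> + e2)) *\<^sub>C x)"
  let ?f = "\<lambda>x. S x - \<mu> *\<^sub>C x"
  have bR: "bounded_clinear R"
    unfolding R_def
    by (rule bounded_clinear_add bounded_clinear_scaleC_const bounded_clinear_compose[OF S] S
        bounded_clinear_id)+
  note lin = clinear_add[OF bounded_clinear_imp_clinear[OF S]]
    clinear_diff[OF bounded_clinear_imp_clinear[OF S]] clinear_scaleC[OF bounded_clinear_imp_clinear[OF S]]
  have key: "k *\<^sub>C S (S (S x)) + (k * (\<mu> - e1)) *\<^sub>C S (S x) + (k * (\<mu>\<^sup>2 - e1 * \<mu> + e2)) *\<^sub>C S x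
      - \<mu> *\<^sub>C (k *\<^sub>C S (S x) + (k * (\<mu> - e1)) *\<^sub>C S x + (k * (\<mu>\<^sup>2 - e1 * \<mu> + e2)) *\<^sub>C x) = x" for x
  proof (rule cinner_ext)
    fix w
    have c: "cinner (S (S (S x))) w = e1 * cinner (S (S x)) w + e3 * cinner x w - e2 * cinner (S x) w"
      using arg_cong[OF cubic[of x], of "\<lambda>v. cinner v w"] by (simp add: cinner_simps algebra_simps)
    have "cinner (k *\<^sub>C S (S (S x)) + (k * (\<mu> - e1)) *\<^sub>C S (S x) + (k * (\<mu>\<^sup>2 - e1 * \<mu> + e2)) *\<^sub>C S x
      - \<mu> *\<^sub>C (k *\<^sub>C S (S x) + (k * (\<mu> - e1)) *\<^sub>C S x + (k * (\<mu>\<^sup>2 - e1 * \<mu> + e2)) *\<^sub>C x)) w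
      = (k * (e1 * \<mu>\<^sup>2 + e3 - (\<mu> ^ 3 + e2 * \<mu>))) * cinner x w"
      unfolding cinner_simps c by (simp add: algebra_simps power2_eq_square power3_eq_cube)
    then show "cinner (k *\<^sub>C S (S (S x)) + (k * (\<mu> - e1)) *\<^sub>C S (S x) + (k * (\<mu>\<^sup>2 - e1 * \<mu> + e2)) *\<^sub>C S x
      - \<mu> *\<^sub>C (k *\<^sub>C S (S x) + (k * (\<mu> - e1)) *\<^sub>C S x + (k * (\<mu>\<^sup>2 - e1 * \<mu> + e2)) *\<^sub>C x)) w = cinner x w"
      by (simp only: k mult_1)
  qed
  have 1: "?f (R x) = x" for x
    using key[of x] by (simp only: R_def lin)
  have 2: "R (?f x) = x" for x
  proof -
    have "R (?f x) = R (S x) - \<mu> *\<^sub>C R x"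
      by (simp only: clinear_diff[OF bounded_clinear_imp_clinear[OF bR]] clinear_scaleC[OF bounded_clinear_imp_clinear[OF bR]])
    then show ?thesis
      using key[of x] by (simp only: R_def)
  qed
  have "bij ?f"
    by (rule o_bij[of R]) (simp_all add: fun_eq_iff 1 2)
  moreover have "inv ?f = R"
    by (rule inv_equality) (simp_all add: 1 2)
  ultimately show ?thesis
    using bR by (simp add: op_spectrum_def)
qed

context
  fixes a :: "'a::spin_factor"
  assumes a: "a \<in> spin_ball"
begin

text \<open>These are the roots of the quadratic in \<open>broot_quadratic\<close>. The smaller one
  is \<open>1 - (spin_norm a)\<^sup>2\<close>, so positivity expresses that \<open>a\<close> lies in
  the ball.\<close>

lemma root_eigenvalues:
  obtains r1 r2 where "0 < r1" "0 < r2" "r1 + r2 = 2 * (1 - (norm a)\<^sup>2)" "r1 * r2 = spin_det a"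
proof
  define \<rho> where "\<rho> = sqrt (((norm a)\<^sup>2)\<^sup>2 - (cmod (quad a))\<^sup>2)"
  have \<rho>: "0 \<le> \<rho>" "\<rho>\<^sup>2 = ((norm a)\<^sup>2)\<^sup>2 - (cmod (quad a))\<^sup>2"
    using quad_sqr_le[of a] by (simp_all add: \<rho>_def)
  have h: "(norm a)\<^sup>2 < 1"
    using norm_less_1[OF a] by (simp add: abs_square_less_1)
  have "\<rho>\<^sup>2 < (1 - (norm a)\<^sup>2)\<^sup>2"
    unfolding \<rho> using spin_det_pos[OF a] by (simp add: spin_det_def power2_diff)
  then have "\<rho> < 1 - (norm a)\<^sup>2"
    by (rule power2_less_imp_less) (use h in simp)
  then show "0 < 1 - (norm a)\<^sup>2 + \<rho>" "0 < 1 - (norm a)\<^sup>2 - \<rho>"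
    using \<rho>(1) by simp_all
  show "(1 - (norm a)\<^sup>2 + \<rho>) * (1 - (norm a)\<^sup>2 - \<rho>) = spin_det a"
    using \<rho>(2) by (simp add: spin_det_def algebra_simps power2_eq_square)
qed simp

lemma op_spectrum_broot: "op_spectrum (broot a) \<subseteq> complex_of_real ` {0<..}"
proof
  fix \<mu> assume \<mu>: "\<mu> \<in> op_spectrum (broot a)"
  define D where "D = complex_of_real (sqrt (spin_det a))"
  define h where "h = complex_of_real ((norm a)\<^sup>2)"
  obtain r1 r2 where r: "0 < r1" "0 < r2" "r1 + r2 = 2 * (1 - (norm a)\<^sup>2)" "r1 * r2 = spin_det a"
    by (rule root_eigenvalues)
  have D2: "D * D = complex_of_real r1 * of_real r2"
    using spin_det_pos[OF a] by (simp add: D_def r(4) flip: of_real_mult)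
  have h: "2 * (1 - h) = complex_of_real r1 + of_real r2"
    using arg_cong[OF r(3), of complex_of_real] by (simp add: h_def)
  have "\<mu> ^ 3 + ((D + 2 * (1 - h)) * D) * \<mu> = (D + 2 * (1 - h)) * \<mu>\<^sup>2 + D ^ 3"
    using not_in_op_spectrum_cubic[OF bounded_clinear_broot broot_cubic[OF a D_def h_def]] \<mu>
    by blast
  then have "(\<mu> - D) * (\<mu>\<^sup>2 - (2 * (1 - h)) * \<mu> + D * D) = 0"
    by (simp add: algebra_simps power2_eq_square power3_eq_cube)
  then have "(\<mu> - D) * ((\<mu> - of_real r1) * (\<mu> - of_real r2)) = 0"
    unfolding h D2 by (simp add: algebra_simps power2_eq_square)
  then have "\<mu> = of_real (sqrt (spin_det a)) \<or> \<mu> = of_real r1 \<or> \<mu> = of_real r2"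
    by (auto simp: D_def)
  then show "\<mu> \<in> complex_of_real ` {0<..}"
    using r(1,2) spin_det_pos[OF a] by auto
qed

text \<open>
  A square root \<open>S\<close> of \<open>B(a,a)\<close> with positive spectrum satisfies the same cubic equation as
  \<open>broot a\<close>, because the polynomial with the opposite roots is injective at \<open>S\<close>; since \<open>S\<^sup>2\<close> is
  prescribed, the cubic equation determines \<open>S\<close>.
\<close>

lemma broot_unique:
  assumes S: "bounded_clinear S" "S \<circ> S = bergman a a" "op_spectrum S \<subseteq> complex_of_real ` {0<..}"
  shows "S = broot a"
proof -
  define D where "D = complex_of_real (sqrt (spin_det a))"
  define h where "h = complex_of_real ((norm a)\<^sup>2)"
  \<comment> \<open>The elementary symmetric functions of \<open>D\<close>, \<open>r1\<close>,
    \<open>r2\<close>; the forms of \<open>e2\<close> and \<open>e3\<close> use that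
    \<open>D * D\<close> equals \<open>r1 * r2\<close>.\<close>
  define e1 where "e1 = D + 2 * (1 - h)"
  define e2 where "e2 = e1 * D"
  define e3 where "e3 = D ^ 3"
  obtain r1 r2 where r: "0 < r1" "0 < r2" "r1 + r2 = 2 * (1 - (norm a)\<^sup>2)" "r1 * r2 = spin_det a"
    by (rule root_eigenvalues)
  have D2: "D * D = complex_of_real r1 * of_real r2"
    using spin_det_pos[OF a] by (simp add: D_def r(4) flip: of_real_mult)
  have h: "2 * (1 - h) = complex_of_real r1 + of_real r2"
    using arg_cong[OF r(3), of complex_of_real] by (simp add: h_def)
  have e2_pos: "e2 = of_real ((sqrt (spin_det a) + (r1 + r2)) * sqrt (spin_det a))"
    "0 < (sqrt (spin_det a) + (r1 + r2)) * sqrt (spin_det a)"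
    using r(1,2) spin_det_pos[OF a] unfolding e1_def e2_def h by (simp_all add: D_def add_pos_pos)
  have inj: "x = 0" if "S x + of_real t *\<^sub>C x = 0" "0 < t" for x and t :: real
  proof -
    have "complex_of_real (- t) \<notin> op_spectrum S"
    proof
      assume "complex_of_real (- t) \<in> op_spectrum S"
      then obtain s where "0 < s" "complex_of_real (- t) = of_real s"
        using S(3) by auto
      then show False
        using \<open>0 < t\<close> by (simp only: of_real_eq_iff)
    qed
    then have "inj (\<lambda>x. S x - of_real (- t) *\<^sub>C x)"
      by (simp add: op_spectrum_def bij_is_inj)
    moreover have "S x - of_real (- t) *\<^sub>C x = S 0 - of_real (- t) *\<^sub>C 0"
      using that(1) clinear_zero[OF bounded_clinear_imp_clinear[OF S(1)]] by simp
    ultimately show ?thesis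
      by (rule injD)
  qed
  note lin = clinear_add[OF bounded_clinear_imp_clinear[OF S(1)]]
    clinear_diff[OF bounded_clinear_imp_clinear[OF S(1)]] clinear_scaleC[OF bounded_clinear_imp_clinear[OF S(1)]]
  note lin0 = clinear_add[OF clinear_broot] clinear_diff[OF clinear_broot] clinear_scaleC[OF clinear_broot]
  \<comment> \<open>The cubic is split into odd and even parts: it reads P T = N for a root T. Both
    operators involve only the square of the root, which \<open>S\<close> and \<open>broot a\<close>
    share, hence they commute with either.\<close>
  define P where "P = (\<lambda>x. broot a (broot a x) + e2 *\<^sub>C x)"
  define N where "N = (\<lambda>x. e1 *\<^sub>C broot a (broot a x) + e3 *\<^sub>C x)"
  have SS: "S (S x) = broot a (broot a x)" for x
    using fun_cong[OF S(2), of x] broot_broot[OF a, of x] by simp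
  have comm: "S (broot a (broot a x)) = broot a (broot a (S x))" for x
    by (simp only: SS[symmetric])
  have SP: "S (P x) = P (S x)" and SN: "S (N x) = N (S x)"
    and PN: "P (N x) = N (P x)" and P_diff: "P (x - y) = P x - P y" and N_diff: "N (x - y) = N x - N y"
    and P0: "broot a (P x) = P (broot a x)" for x y
    by (simp_all add: P_def N_def lin lin0 comm scaleC_add_right scaleC_scaleC scaleC.scale_right_diff_distrib
        ac_simps)
  have PN0: "P (broot a x) = N x" for x
    using broot_cubic[OF a D_def h_def, of x, folded e1_def, folded e2_def e3_def]
    by (simp add: P_def N_def)
  have PPB: "P (P (S (S x))) = N (N x)" for x
    by (simp only: SS PN0[symmetric] P0)
  have "S x = broot a x" for x
  proof -
    \<comment> \<open>The value of the cubic at \<open>S\<close>. As P P S S = N N, it is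
      annihilated by P S + N, which factors as (S + D)(S + r1)(S + r2) with injective
      factors.\<close>
    define y where "y = P (S x) - N x"
    have "P (S y) + N y = 0"
      by (simp add: y_def lin P_diff N_diff SP SN PN PPB[symmetric])
    moreover have "P (S y) + N y = S (S (S y) + of_real r1 *\<^sub>C S y + of_real r2 *\<^sub>C (S y + of_real r1 *\<^sub>C y))
        + D *\<^sub>C (S (S y) + of_real r1 *\<^sub>C S y + of_real r2 *\<^sub>C (S y + of_real r1 *\<^sub>C y))"
    proof (rule cinner_ext)
      fix w
      have e1: "e1 = D + (of_real r1 + of_real r2)"
        unfolding e1_def h ..
      have e2: "e2 = (D + (of_real r1 + of_real r2)) * D"
        unfolding e2_def e1 ..
      have "e2 = of_real r1 * of_real r2 + (of_real r1 + of_real r2) * D"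
        unfolding e2 distrib_right[of D] D2 ..
      moreover have "e3 = of_real r1 * of_real r2 * D"
        unfolding e3_def power3_eq_cube D2 ..
      moreover note e1
      ultimately have e: "e1 = D + (of_real r1 + of_real r2)" "e3 = of_real r1 * of_real r2 * D"
        "e2 = of_real r1 * of_real r2 + (of_real r1 + of_real r2) * D"
        by blast+
      show "cinner (P (S y) + N y) w = cinner (S (S (S y) + of_real r1 *\<^sub>C S y + of_real r2 *\<^sub>C (S y + of_real r1 *\<^sub>C y))
        + D *\<^sub>C (S (S y) + of_real r1 *\<^sub>C S y + of_real r2 *\<^sub>C (S y + of_real r1 *\<^sub>C y))) w"
        unfolding P_def N_def lin SS[symmetric] cinner_simps e by (simp add: algebra_simps)
    qed
    ultimately have "S (S y) + of_real r1 *\<^sub>C S y + of_real r2 *\<^sub>C (S y + of_real r1 *\<^sub>C y) = 0"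
      using real_sqrt_gt_zero[OF spin_det_pos[OF a]] unfolding D_def by (metis inj)
    then have "S (S y + of_real r1 *\<^sub>C y) + of_real r2 *\<^sub>C (S y + of_real r1 *\<^sub>C y) = 0"
      by (simp only: lin)
    then have "S y + of_real r1 *\<^sub>C y = 0"
      by (rule inj) (rule r(2))
    then have "y = 0"
      by (rule inj) (rule r(1))
    then have "P (S x - broot a x) = 0"
      by (simp add: P_diff PN0 y_def)
    \<comment> \<open>\<open>P\<close> is the square of the self-adjoint \<open>broot a\<close> plus
      a positive multiple of the identity, so \<open>cinner (P v) v\<close> vanishes only for
      \<open>v = 0\<close>.\<close>
    define v where "v = S x - broot a x"
    have "cinner (P v) v = of_real ((norm (broot a v))\<^sup>2) + e2 * of_real ((norm v)\<^sup>2)"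
      by (simp only: P_def cinner_simps broot_adjoint[OF a, of "broot a v" v] cinner_same)
    also have "\<dots> = of_real ((norm (broot a v))\<^sup>2
        + (sqrt (spin_det a) + (r1 + r2)) * sqrt (spin_det a) * (norm v)\<^sup>2)"
      unfolding e2_pos(1) of_real_add of_real_mult ..
    finally have "complex_of_real ((norm (broot a v))\<^sup>2
        + (sqrt (spin_det a) + (r1 + r2)) * sqrt (spin_det a) * (norm v)\<^sup>2) = 0"
      using \<open>P (S x - broot a x) = 0\<close> by (simp only: v_def cinner_zero_left)
    then have "(norm (broot a v))\<^sup>2 + (sqrt (spin_det a) + (r1 + r2)) * sqrt (spin_det a) * (norm v)\<^sup>2 = 0"
      by (simp only: of_real_eq_0_iff)
    moreover have "0 \<le> (norm (broot a v))\<^sup>2" by simp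
    moreover have "0 < (sqrt (spin_det a) + (r1 + r2)) * sqrt (spin_det a) * (norm v)\<^sup>2" if "v \<noteq> 0"
      using e2_pos(2) that by (intro mult_pos_pos[OF e2_pos(2)]) simp
    ultimately have "v = 0"
      by linarith
    then show ?thesis
      by (simp add: v_def)
  qed
  then show ?thesis
    by (rule ext)
qed

lemma bergman_root_eq: "bergman_root a = broot a"
  unfolding bergman_root_def
proof (rule the_equality)
  show "bounded_clinear (broot a) \<and> broot a \<circ> broot a = bergman a a \<and>
      op_spectrum (broot a) \<subseteq> complex_of_real ` {0<..}"
    using bounded_clinear_broot op_spectrum_broot broot_broot[OF a] by (auto simp: fun_eq_iff)
qed (use broot_unique in blast)

end

section \<open>Transvections\<close>

lemma spin_norm_scaleC: "spin_norm (c *\<^sub>C x) = cmod c * spin_norm x"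
proof -
  have "((norm (c *\<^sub>C x))\<^sup>2)\<^sup>2 - (cmod (quad (c *\<^sub>C x)))\<^sup>2
    = ((cmod c)\<^sup>2)\<^sup>2 * (((norm x)\<^sup>2)\<^sup>2 - (cmod (quad x))\<^sup>2)"
    by (simp add: norm_scaleC quad_scaleC norm_mult norm_power power_mult_distrib right_diff_distrib)
  then have "sqrt (((norm (c *\<^sub>C x))\<^sup>2)\<^sup>2 - (cmod (quad (c *\<^sub>C x)))\<^sup>2)
    = (cmod c)\<^sup>2 * sqrt (((norm x)\<^sup>2)\<^sup>2 - (cmod (quad x))\<^sup>2)"
    by (simp only: real_sqrt_mult real_sqrt_abs abs_power2)
  then have "(norm (c *\<^sub>C x))\<^sup>2 + sqrt (((norm (c *\<^sub>C x))\<^sup>2)\<^sup>2 - (cmod (quad (c *\<^sub>C x)))\<^sup>2)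
    = (cmod c)\<^sup>2 * ((norm x)\<^sup>2 + sqrt (((norm x)\<^sup>2)\<^sup>2 - (cmod (quad x))\<^sup>2))"
    by (simp only: norm_scaleC power_mult_distrib distrib_left)
  then show ?thesis
    unfolding spin_norm_alt by (simp add: real_sqrt_mult)
qed

lemma spin_norm_nonneg: "0 \<le> spin_norm x"
  using quad_sqr_le[of x] by (simp add: spin_norm_alt)

text \<open>Over the denominator \<open>qdenom a x\<close>, this is the numerator of
  \<open>quad (transvection a x)\<close>, and \<open>tnum\<close> that of
  \<open>transvection a x\<close>. Identities between them make sense before the denominator is
  known to be nonzero.\<close>

definition qnum :: "'a::spin_factor \<Rightarrow> 'a \<Rightarrow> complex"
  where "qnum a x = quad a + 2 * cinner x (conjn a) + quad x"

definition tnum :: "'a::spin_factor \<Rightarrow> 'a \<Rightarrow> 'a"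
  where "tnum a x = qdenom a x *\<^sub>C a + broot a (x + quad x *\<^sub>C conjn a)"

text \<open>For self-adjoint \<open>broot a\<close> this is the squared Hilbert norm of
  \<open>broot a z\<close>, as needed for the norm of \<open>tnum\<close>.\<close>

lemma cinner_bergman_same:
  "cinner (bergman a a z) z = cinner z z
     - 2 * (cinner a a * cinner z z + cinner z a * cnj (cinner z a)
       - cinner z (conjn a) * cnj (cinner z (conjn a)))
     + (2 * (2 * cinner z a * cinner a a - cnj (quad a) * cinner z (conjn a)) * cnj (cinner z a)
        - quad a * (2 * cinner z a * cnj (cinner z (conjn a)) - cnj (quad a) * cinner z z))"
proof -
  have [simp]: "cnj (cinner a a) = cinner a a"
    by (simp flip: cinner_commute)
  show ?thesis
    by (simp add: bergman_def D_op_def Q_op_def triple_def cinner_simps conjn_simps quad_conjn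
         cinner_conjn_right[of a z] cinner_commute[of a z] cinner_conjn_left[of a z]
         cinner_conjn_left[of a a] cinner_conjn_left[of z z] cinner_conjn_conjn' algebra_simps flip: quad_def)
qed

lemma quad_shift: "quad (x + quad x *\<^sub>C conjn a) = quad x * qdenom a x"
  unfolding quad_add quad_scaleC quad_conjn qdenom_def conjn_simps cinner_simps
  by (simp add: power2_eq_square algebra_simps)

context
  fixes a :: "'a::spin_factor"
  assumes a: "a \<in> spin_ball"
begin

lemma quad_tnum: "quad (tnum a x) = qdenom a x * qnum a x"
proof -
  have i: "cinner (conjn a) (conjn a) = cinner a a" "cinner (conjn a) a = cnj (quad a)"
    by (simp_all add: cinner_conjn_conjn' cinner_conjn_left[of a a] quad_def)
  have d: "complex_of_real (spin_det a) = 1 - 2 * cinner a a + quad a * cnj (quad a)"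
    by (simp only: spin_det_def of_real_add of_real_diff of_real_mult of_real_1 of_real_numeral
        complex_norm_square cinner_same)
  have "quad (tnum a x) = (qdenom a x)\<^sup>2 * quad a
      + 2 * qdenom a x * cinner (broot a (x + quad x *\<^sub>C conjn a)) (conjn a)
      + of_real (spin_det a) * (quad x * qdenom a x)"
    unfolding tnum_def quad_add[of "qdenom a x *\<^sub>C a"] quad_scaleC quad_broot[OF a] quad_shift
    by (simp add: cinner_scaleC_left cinner_conjn_right[of a])
  also have "\<dots> = qdenom a x * (qdenom a x * quad a
      + 2 * (cinner x (conjn a) + quad x * cinner a a - quad a * (cinner x a + quad x * cnj (quad a)))
      + of_real (spin_det a) * quad x)"
    unfolding broot_adjoint[OF a] broot_conjn[OF a] cinner_simps i
    by (simp add: algebra_simps power2_eq_square)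
  also have "\<dots> = qdenom a x * qnum a x"
    unfolding d qdenom_def qnum_def by (simp add: algebra_simps)
  finally show ?thesis .
qed

text \<open>The transformation rule of \<open>spin_det\<close> under the transvection, with
  denominators cleared. No condition on \<open>x\<close> is imposed, so it can serve to prove that
  the denominator does not vanish.\<close>

lemma norm_tnum:
  "(cmod (qdenom a x))\<^sup>2 + (cmod (qnum a x))\<^sup>2 - 2 * (norm (tnum a x))\<^sup>2 = spin_det a * spin_det x"
proof -
  \<comment> \<open>Each scalar and its conjugate get separate names, which leaves a polynomial
    identity in commuting letters.\<close>
  define h where "h = cinner a a"
  define k where "k = cinner x x"
  define q where "q = quad a"
  define q' where "q' = cnj q"
  define p where "p = quad x"
  define p' where "p' = cnj p"
  define s where "s = cinner x a"
  define s' where "s' = cnj s"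
  define r where "r = cinner x (conjn a)"
  define r' where "r' = cnj r"
  define \<delta> where "\<delta> = 1 + 2 * s + p * q'"
  define \<delta>' where "\<delta>' = 1 + 2 * s' + p' * q"
  have c: "cnj h = h" "cnj k = k" "cnj q = q'" "cnj q' = q" "cnj p = p'" "cnj p' = p" "cnj s = s'" "cnj s' = s"
    "cnj r = r'" "cnj r' = r"
    by (simp_all add: h_def k_def q'_def p'_def s'_def r'_def flip: cinner_commute)
  have \<delta>: "qdenom a x = \<delta>" "cnj \<delta> = \<delta>'"
    by (simp_all add: \<delta>_def \<delta>'_def qdenom_def q_def q'_def p_def p'_def s_def s'_def)
  have i: "cinner a a = h" "cinner (conjn a) (conjn a) = h" "cinner (conjn a) a = q'" "cinner a (conjn a) = q"
    "cinner x a = s" "cinner a x = s'" "cinner x (conjn a) = r" "cinner (conjn a) x = r'" "cinner x x = k"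
    by (simp_all add: cinner_conjn_conjn' cinner_commute[of "conjn a" a] cinner_commute[of "conjn a" x]
        cinner_commute[of a x] quad_def h_def k_def q_def q'_def s_def s'_def r_def r'_def)
  define w where "w = x + p *\<^sub>C conjn a"
  define S where "S = s + p * q'"
  define R where "R = r + p * h"
  define S' where "S' = s' + p' * q"
  define R' where "R' = r' + p' * h"
  define H where "H = k + p' * r + p * r' + p * p' * h"
  have w: "cinner w a = S" "cinner w (conjn a) = R" "cinner w w = H" "cnj S = S'" "cnj R = R'"
    by (simp_all add: w_def S_def R_def S'_def R'_def H_def cinner_simps i c algebra_simps)
  have wa: "cinner (broot a w) a = (1 - 2 * h) * S + q' * R"
    unfolding broot_adjoint[OF a] broot_self[OF a] cinner_simps w
    by (simp add: q'_def q_def h_def cinner_same)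
  have "cinner a (broot a w) = cnj (cinner (broot a w) a)"
    by (rule cinner_commute)
  then have aw: "cinner a (broot a w) = (1 - 2 * h) * S' + q * R'"
    unfolding wa by (simp add: w c)
  have ww: "cinner (broot a w) (broot a w) = H - 2 * (h * H + S * S' - R * R')
     + (2 * (2 * S * h - q' * R) * S' - q * (2 * S * R' - q' * H))"
    unfolding broot_adjoint[OF a, of "broot a w" w, symmetric] broot_broot[OF a] cinner_bergman_same w i
    by (simp add: q_def q'_def)
  have "of_real ((norm (tnum a x))\<^sup>2) = cinner (tnum a x) (tnum a x)"
    by (rule cinner_same[symmetric])
  also have "\<dots> = \<delta> * \<delta>' * h + \<delta> * ((1 - 2 * h) * S' + q * R') + \<delta>' * ((1 - 2 * h) * S + q' * R)
     + (H - 2 * (h * H + S * S' - R * R')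
     + (2 * (2 * S * h - q' * R) * S' - q * (2 * S * R' - q' * H)))"
    unfolding tnum_def p_def[symmetric] w_def[symmetric] cinner_simps wa aw ww \<delta> i
    by (simp only: algebra_simps)
  finally have n: "of_real ((norm (tnum a x))\<^sup>2) = \<dots>" .
  have m: "qnum a x = q + 2 * r + p"
    by (simp add: qnum_def q_def r_def p_def)
  have "complex_of_real ((cmod (qdenom a x))\<^sup>2 + (cmod (qnum a x))\<^sup>2 - 2 * (norm (tnum a x))\<^sup>2)
      = \<delta> * \<delta>' + (q + 2 * r + p) * (q' + 2 * r' + p') - 2 * (\<delta> * \<delta>' * h + \<delta> * ((1 - 2 * h) * S' + q * R') + \<delta>' * ((1 - 2 * h) * S + q' * R)
     + (H - 2 * (h * H + S * S' - R * R')
     + (2 * (2 * S * h - q' * R) * S' - q * (2 * S * R' - q' * H))))"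
    by (simp only: of_real_add of_real_diff of_real_mult of_real_numeral complex_norm_square n)
      (simp add: m \<delta> c)
  also have "\<dots> = (1 - 2 * h + q * q') * (1 - 2 * k + p * p')"
    unfolding \<delta>_def \<delta>'_def S_def S'_def R_def R'_def H_def
    by (simp add: algebra_simps)
  also have "\<dots> = of_real (spin_det a * spin_det x)"
    by (simp only: spin_det_def of_real_add of_real_diff of_real_mult of_real_1 of_real_numeral
        complex_norm_square h_def k_def cinner_same q'_def p'_def q_def p_def)
  finally show ?thesis
    using of_real_eq_iff by blast
qed

end

lemma quad_shift_diff:
  assumes "qdenom a x \<noteq> 0" "qdenom a y \<noteq> 0"
  shows "quad (inverse (qdenom a x) *\<^sub>C (x + quad x *\<^sub>C conjn a)
      - inverse (qdenom a y) *\<^sub>C (y + quad y *\<^sub>C conjn a))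
    = quad (x - y) / (qdenom a x * qdenom a y)"
proof -
  define u where "u = inverse (qdenom a x)"
  define v where "v = inverse (qdenom a y)"
  have u: "u * qdenom a x = 1" and v: "v * qdenom a y = 1"
    using assms by (simp_all add: u_def v_def)
  have i: "cinner (conjn a) a = cnj (quad a)" "cinner (conjn a) (conjn y) = cinner y a"
    by (simp_all add: cinner_commute[of "conjn a" a] quad_def cinner_conjn_conjn')
  have c: "cinner (x + quad x *\<^sub>C conjn a) (conjn (y + quad y *\<^sub>C conjn a))
      = cinner x (conjn y) + quad y * cinner x a + quad x * cinner y a + quad x * quad y * cnj (quad a)"
    unfolding conjn_simps cinner_simps i by (simp add: algebra_simps)
  have "quad (u *\<^sub>C (x + quad x *\<^sub>C conjn a) - v *\<^sub>C (y + quad y *\<^sub>C conjn a))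
      = u\<^sup>2 * (quad x * qdenom a x) - 2 * (u * v * cinner (x + quad x *\<^sub>C conjn a) (conjn (y + quad y *\<^sub>C conjn a)))
        + v\<^sup>2 * (quad y * qdenom a y)"
    unfolding quad_diff quad_scaleC quad_shift conjn_scaleC cinner_scaleC_left cinner_scaleC_right
    by simp
  \<comment> \<open>One \<open>u\<close> cancels \<open>qdenom a x\<close>, and the factor
    \<open>v * qdenom a y = 1\<close> is inserted; all three terms then share
    \<open>u * v\<close>.\<close>
  also have "u\<^sup>2 * (quad x * qdenom a x) = u * v * (quad x * qdenom a y)"
    using u v by algebra
  also have "v\<^sup>2 * (quad y * qdenom a y) = u * v * (quad y * qdenom a x)"
    using u v by algebra
  finally have "quad (u *\<^sub>C (x + quad x *\<^sub>C conjn a) - v *\<^sub>C (y + quad y *\<^sub>C conjn a))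
      = u * v * (quad x - 2 * cinner x (conjn y) + quad y)"
    unfolding c qdenom_def by (simp add: algebra_simps)
  then show ?thesis
    unfolding quad_diff[of x y] u_def v_def by (simp add: field_simps)
qed

section \<open>Nonvanishing of the denominator and the closed form of the transvection\<close>

lemma spin_norm_scaleR: "spin_norm (r *\<^sub>R x) = \<bar>r\<bar> * spin_norm x"
  by (simp add: scaleR_scaleC spin_norm_scaleC)

lemma qdenom_scaleR: "r \<noteq> 0 \<Longrightarrow> qdenom (inverse r *\<^sub>R a) (r *\<^sub>R x) = qdenom a x"
  by (simp add: qdenom_def quad_scaleC scaleR_scaleC cinner_scaleC_left cinner_scaleC_right field_simps)

text \<open>
  The inequality \<open>\<bar>qnum a x\<bar> < \<bar>qdenom a x\<bar>\<close> holds at \<open>x = 0\<close> and persists along the segment to \<open>x\<close>,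
  because equality is impossible by \<open>norm_tnum\<close> and \<open>\<bar>quad (tnum a x)\<bar> \<le> (norm (tnum a x))\<^sup>2\<close>.
\<close>

lemma qdenom_nonzero_ball:
  assumes a: "a \<in> spin_ball" and x: "x \<in> spin_ball"
  shows "qdenom a x \<noteq> 0"
proof -
  define \<phi> where "\<phi> = (\<lambda>t::real. cmod (qdenom a (t *\<^sub>R x)) - cmod (qnum a (t *\<^sub>R x)))"
  have ne: "\<phi> t \<noteq> 0" if "0 \<le> t" "t \<le> 1" for t
  proof
    assume "\<phi> t = 0"
    then have eq: "cmod (qdenom a (t *\<^sub>R x)) = cmod (qnum a (t *\<^sub>R x))"
      by (simp add: \<phi>_def)
    have "spin_norm (t *\<^sub>R x) < 1"
      using x that mult_left_le_one_le[OF spin_norm_nonneg, of t x]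
      by (simp add: spin_ball_def spin_norm_scaleR)
    then have "0 < spin_det a * spin_det (t *\<^sub>R x)"
      using spin_det_pos[OF a] by (simp add: spin_norm_less_1_iff)
    moreover have "cmod (qdenom a (t *\<^sub>R x)) * cmod (qnum a (t *\<^sub>R x)) \<le> (norm (tnum a (t *\<^sub>R x)))\<^sup>2"
      using quad_le[of "tnum a (t *\<^sub>R x)"] by (simp add: quad_tnum[OF a] norm_mult)
    ultimately show False
      using norm_tnum[OF a, of "t *\<^sub>R x"] unfolding eq power2_eq_square by linarith
  qed
  have quadR: "quad (t *\<^sub>R x) = of_real (t\<^sup>2) * quad x" for t
    by (simp add: scaleR_scaleC quad_scaleC)
  have "continuous_on {0..1} \<phi>"
    unfolding \<phi>_def qdenom_def qnum_def quadR cinner_scaleR_left by (intro continuous_intros)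
  moreover have "cmod (quad a) < 1"
    using quad_le[of a] norm_less_1[OF a] abs_square_less_1[of "norm a"] by simp
  then have "0 < \<phi> 0"
    by (simp add: \<phi>_def qdenom_def qnum_def quad_def[of 0])
  ultimately have "0 \<le> \<phi> 1"
    using IVT2'[of \<phi> 1 0 0] ne by fastforce
  then have "0 < \<phi> 1"
    using ne[of 1] by simp
  then show ?thesis
    by (auto simp: \<phi>_def)
qed

text \<open>The norm of \<open>a\<close> is strictly below one, so a factor \<open>r\<close> between
  it and one can be shifted: \<open>a / r\<close> and \<open>r x\<close> both lie in the open ball
  and have the same denominator.\<close>

lemma qdenom_nonzero:
  assumes a: "a \<in> spin_ball" and x: "spin_norm x \<le> 1"
  shows "qdenom a x \<noteq> 0"
proof -
  obtain r where r: "spin_norm a < r" "r < 1"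
    using a dense by (auto simp: spin_ball_def)
  then have r0: "0 < r"
    using spin_norm_nonneg[of a] by linarith
  have "r * spin_norm x \<le> r"
    using x r0 by (simp add: mult_left_le)
  then have "\<bar>r\<bar> * spin_norm x < 1"
    using r r0 by linarith
  then have "r *\<^sub>R x \<in> spin_ball"
    by (simp only: spin_ball_def mem_Collect_eq spin_norm_scaleR)
  moreover have "inverse r *\<^sub>R a \<in> spin_ball"
    using r r0 by (auto simp: spin_ball_def spin_norm_scaleR field_simps)
  ultimately show ?thesis
    using r0 qdenom_nonzero_ball[of "inverse r *\<^sub>R a" "r *\<^sub>R x"] by (simp add: qdenom_scaleR)
qed

context
  fixes a x :: "'a::spin_factor"
  assumes a: "a \<in> spin_ball" and x: "spin_norm x \<le> 1"
begin

lemma transvection_eq_root: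
  "transvection a x = a + broot a (inverse (qdenom a x) *\<^sub>C (x + quad x *\<^sub>C conjn a))"
proof -
  have "norm x \<le> 1" "norm a < 1"
    using x norm_less_1[OF a] by (simp_all add: spin_norm_le_1_iff)
  then have "norm x * norm a < 1"
    using mult_right_mono[of "norm x" 1 "norm a"] by simp
  then show ?thesis
    by (simp add: transvection_def bergman_root_eq[OF a] quasi_inverse_eq[OF qdenom_nonzero[OF a x]])
qed

lemma transvection_eq: "transvection a x = inverse (qdenom a x) *\<^sub>C tnum a x"
  unfolding transvection_eq_root tnum_def scaleC_add_right[of "inverse (qdenom a x)" "_ *\<^sub>C a"]
    clinear_scaleC[OF clinear_broot] scaleC_scaleC
  using qdenom_nonzero[OF a x] by simp

lemma quad_transvection: "quad (transvection a x) = qnum a x / qdenom a x"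
  using qdenom_nonzero[OF a x]
  by (simp add: transvection_eq quad_scaleC quad_tnum[OF a] power2_eq_square field_simps)

lemma spin_det_transvection:
  "spin_det (transvection a x) * (cmod (qdenom a x))\<^sup>2 = spin_det a * spin_det x"
proof -
  have "(norm (tnum a x))\<^sup>2 = (norm (transvection a x))\<^sup>2 * (cmod (qdenom a x))\<^sup>2"
  proof -
    have "tnum a x = qdenom a x *\<^sub>C transvection a x"
      using qdenom_nonzero[OF a x] by (simp add: transvection_eq scaleC_scaleC)
    then show ?thesis
      by (simp add: norm_scaleC power_mult_distrib)
  qed
  moreover have "(cmod (qnum a x))\<^sup>2 = (cmod (quad (transvection a x)))\<^sup>2 * (cmod (qdenom a x))\<^sup>2"
    using qdenom_nonzero[OF a x] by (simp add: quad_transvection norm_divide field_simps)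
  ultimately show ?thesis
    using norm_tnum[OF a, of x] by (simp add: spin_det_def algebra_simps)
qed

end

lemma quad_transvection_diff:
  assumes a: "a \<in> spin_ball" and x: "spin_norm x \<le> 1" and y: "spin_norm y \<le> 1"
  shows "quad (transvection a x - transvection a y)
    = of_real (spin_det a) * quad (x - y) / (qdenom a x * qdenom a y)"
proof -
  have "transvection a x - transvection a y
      = broot a (inverse (qdenom a x) *\<^sub>C (x + quad x *\<^sub>C conjn a)
          - inverse (qdenom a y) *\<^sub>C (y + quad y *\<^sub>C conjn a))"
    by (simp add: transvection_eq_root[OF a x] transvection_eq_root[OF a y] clinear_diff[OF clinear_broot])
  then show ?thesis
    by (simp add: quad_broot[OF a] quad_shift_diff[OF qdenom_nonzero[OF a x] qdenom_nonzero[OF a y]])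
qed

section \<open>Isometries\<close>

lemma norm_le_spin_norm: "norm x \<le> spin_norm x"
  using quad_sqr_le[of x] by (auto simp: spin_norm_alt intro: real_le_rsqrt)

lemma spin_norm_eq_1_det:
  assumes "spin_norm x = 1"
  shows "spin_det x = 0"
proof -
  have "sqrt (((norm x)\<^sup>2)\<^sup>2 - (cmod (quad x))\<^sup>2) = 1 - (norm x)\<^sup>2"
    using assms by (simp add: spin_norm_alt)
  then have "((norm x)\<^sup>2)\<^sup>2 - (cmod (quad x))\<^sup>2 = (1 - (norm x)\<^sup>2)\<^sup>2"
    using quad_sqr_le[of x] by (metis diff_ge_0_iff_ge real_sqrt_pow2)
  then show ?thesis
    by (simp add: spin_det_def power2_eq_square algebra_simps)
qed

lemma surj_linear_isometry_bij:
  fixes T :: "'a::spin_factor \<Rightarrow> 'a"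
  assumes "surj_linear_isometry T"
  shows "bij T"
  unfolding bij_def
proof
  show "surj T"
    using assms by (simp add: surj_linear_isometry_def)
  show "inj T"
  proof (rule injI)
    fix x y assume "T x = T y"
    then have "T (x - y) = T 0"
      using assms by (simp add: surj_linear_isometry_def clinear_diff clinear_zero)
    then have "spin_norm (x - y) = spin_norm (0 :: 'a)"
    proof -
      have "spin_norm (T (x - y)) = spin_norm (T 0)"
        by (simp only: \<open>T (x - y) = T 0\<close>)
      then show ?thesis
        using assms by (simp add: surj_linear_isometry_def)
    qed
    then have "spin_norm (x - y) = 0"
      by (simp add: spin_norm_alt quad_def)
    then show "x = y"
      using norm_le_spin_norm[of "x - y"] by simp
  qed
qed

lemma surj_linear_isometry_inv:
  assumes T: "surj_linear_isometry T"
  shows "surj_linear_isometry (inv T)"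
proof -
  have b: "bij T"
    by (rule surj_linear_isometry_bij[OF T])
  have TI: "T (inv T x) = x" and IT: "inv T (T x) = x" for x
    using b by (simp_all add: bij_is_surj surj_f_inv_f bij_is_inj)
  have c: "clinear T" "\<And>x. spin_norm (T x) = spin_norm x"
    using T by (simp_all add: surj_linear_isometry_def)
  have "inv T (x + y) = inv T x + inv T y" for x y
    using IT[of "inv T x + inv T y"] by (simp add: clinear_add[OF c(1)] TI)
  moreover have "inv T (k *\<^sub>C x) = k *\<^sub>C inv T x" for k x
    using IT[of "k *\<^sub>C inv T x"] by (simp add: clinear_scaleC[OF c(1)] TI)
  ultimately have "clinear (inv T)"
    by (rule clinearI)
  moreover have "spin_norm (inv T x) = spin_norm x" for x
    using c(2)[of "inv T x"] by (simp add: TI)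
  ultimately show ?thesis
    using b by (simp add: surj_linear_isometry_def bij_betw_inv_into bij_is_surj bij_imp_bij_inv)
qed

text \<open>
  If \<open>spin_norm x = 1\<close> and \<open>cmod (quad x) < 1\<close>, write \<open>x = e\<^sub>1 + t e\<^sub>2\<close> with orthogonal minimal tripotents;
  the vector \<open>w\<close> is a multiple of \<open>e\<^sub>2\<close> and \<open>t < 1\<close> leaves room to move in its direction.
\<close>

lemma not_extreme_point:
  assumes x: "spin_norm x = 1" and q: "cmod (quad x) \<noteq> 1"
  obtains w where "w \<noteq> 0" "spin_norm (x + w) \<le> 1" "spin_norm (x - w) \<le> 1"
proof -
  define t where "t = cmod (quad x)"
  have "spin_norm x \<le> 1"
    using x by simp
  then have "(norm x)\<^sup>2 \<le> 1"
    by (simp add: spin_norm_le_1_iff abs_square_le_1)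
  then have t: "0 \<le> t" "t < 1"
    using quad_le[of x] q by (simp_all add: t_def)
  have h: "2 * (norm x)\<^sup>2 = 1 + t\<^sup>2"
    using spin_norm_eq_1_det[OF x] by (simp add: spin_det_def t_def)
  define w where "w = conjn x - cnj (quad x) *\<^sub>C x"
  have xx: "2 * cinner x x = 1 + quad x * cnj (quad x)"
    using arg_cong[OF h, of complex_of_real]
    by (simp only: t_def cinner_same of_real_mult of_real_add of_real_1 of_real_numeral complex_norm_square)
  have i: "cinner (conjn x) (conjn x) = cinner x x" "cinner x (conjn x) = quad x" "cinner (conjn x) x = cnj (quad x)"
    by (simp_all add: cinner_conjn_conjn' cinner_commute[of "conjn x" x] quad_def)
  have qw: "quad w = 0"
  proof -
    have "quad w = cnj (quad x) - cnj (quad x) * (2 * cinner x x) + (cnj (quad x))\<^sup>2 * quad x"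
      unfolding w_def quad_diff quad_scaleC quad_conjn conjn_simps cinner_simps i by simp
    then show ?thesis
      unfolding xx by (simp add: algebra_simps power2_eq_square)
  qed
  have xw: "2 * cinner x (conjn w) = of_real (1 - t\<^sup>2)"
  proof -
    have "2 * cinner x (conjn w) = 2 * cinner x x - 2 * (quad x * cnj (quad x))"
      unfolding w_def conjn_simps cinner_simps i by simp
    then show ?thesis
      unfolding xx t_def by (simp only: of_real_diff of_real_1 complex_norm_square) simp
  qed
  have xw': "2 * cinner x w = quad x * of_real (1 - t\<^sup>2)"
  proof -
    have "2 * cinner x w = 2 * quad x - quad x * (2 * cinner x x)"
      unfolding w_def cinner_simps i by simp
    then show ?thesis
      unfolding xx t_def by (simp only: of_real_diff of_real_1 complex_norm_square) (simp add: algebra_simps)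
  qed
  have ww: "2 * (norm w)\<^sup>2 = (1 - t\<^sup>2)\<^sup>2"
  proof -
    have "2 * complex_of_real ((norm w)\<^sup>2) = 2 * cinner x x - 4 * (quad x * cnj (quad x)) + (quad x * cnj (quad x)) * (2 * cinner x x)"
      unfolding cinner_same[symmetric] w_def cinner_simps i by (simp add: algebra_simps)
    also have "\<dots> = (1 - quad x * cnj (quad x))\<^sup>2"
      unfolding xx by (simp add: algebra_simps power2_eq_square)
    also have "\<dots> = of_real ((1 - t\<^sup>2)\<^sup>2)"
      unfolding t_def by (simp only: of_real_diff of_real_1 of_real_power[of "1 - _"] complex_norm_square)
    finally have "complex_of_real (2 * (norm w)\<^sup>2) = of_real ((1 - t\<^sup>2)\<^sup>2)"
      by simp
    then show ?thesis
      by (simp only: of_real_eq_iff)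
  qed
  have le: "spin_norm (x + c *\<^sub>R w) \<le> 1" if c: "\<bar>c\<bar> \<le> 1 - t" for c
  proof -
    have q: "quad (x + c *\<^sub>R w) = quad x + of_real (c * (1 - t\<^sup>2))"
      using xw by (simp add: quad_add scaleR_scaleC quad_scaleC qw conjn_simps cinner_simps)
    have q2: "(cmod (quad (x + c *\<^sub>R w)))\<^sup>2 = t\<^sup>2 + 2 * (c * (1 - t\<^sup>2)) * Re (quad x) + (c * (1 - t\<^sup>2))\<^sup>2"
      unfolding q t_def cmod_power2 by (simp add: power2_eq_square algebra_simps)
    have "2 * Re (cinner x w) = Re (quad x) * (1 - t\<^sup>2)"
      using arg_cong[OF xw', of Re] by simp
    then have xw'': "2 * inner x w = Re (quad x) * (1 - t\<^sup>2)"
      by (simp only: inner_eq_Re_cinner)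
    \<comment> \<open>The determinant stays zero along this line, so membership in the closed ball
      comes down to the modulus of \<open>quad\<close> being at most one.\<close>
    have "2 * (norm (x + c *\<^sub>R w))\<^sup>2 = 2 * (norm x)\<^sup>2 + 2 * c * (2 * inner x w) + c\<^sup>2 * (2 * (norm w)\<^sup>2)"
      by (simp add: power2_norm_eq_inner inner_add_left inner_add_right inner_commute[of w x])
        (simp add: power2_eq_square algebra_simps)
    also have "\<dots> = 1 + (cmod (quad (x + c *\<^sub>R w)))\<^sup>2"
      unfolding q2 h ww xw'' by (simp add: power2_eq_square algebra_simps)
    finally have "2 * (norm (x + c *\<^sub>R w))\<^sup>2 = 1 + (cmod (quad (x + c *\<^sub>R w)))\<^sup>2" .
    moreover have "cmod (quad (x + c *\<^sub>R w)) \<le> 1"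
    proof -
      have "cmod (quad (x + c *\<^sub>R w)) \<le> t + \<bar>c\<bar> * (1 - t\<^sup>2)"
        unfolding q t_def using norm_triangle_ineq[of "quad x" "of_real (c * (1 - t\<^sup>2))"] t
        by (simp add: t_def abs_mult power_le_one del: of_real_mult)
      also have "\<dots> \<le> t + \<bar>c\<bar> * 1"
        using t by (intro add_left_mono mult_left_mono) auto
      finally show ?thesis
        using c by simp
    qed
    then have "(cmod (quad (x + c *\<^sub>R w)))\<^sup>2 \<le> 1"
      by (simp add: abs_square_le_1)
    ultimately have "(norm (x + c *\<^sub>R w))\<^sup>2 \<le> 1" "spin_det (x + c *\<^sub>R w) = 0"
      unfolding spin_det_def by linarith+
    then show ?thesis
      by (simp add: spin_norm_le_1_iff abs_square_le_1)
  qed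
  have "t\<^sup>2 < 1"
    using t by (simp add: abs_square_less_1)
  then have "w \<noteq> 0"
    using ww by auto
  show ?thesis
  proof (rule that[of "(1 - t) *\<^sub>R w"])
    show "(1 - t) *\<^sub>R w \<noteq> 0"
      using \<open>w \<noteq> 0\<close> t by simp
    show "spin_norm (x + (1 - t) *\<^sub>R w) \<le> 1" "spin_norm (x - (1 - t) *\<^sub>R w) \<le> 1"
      using le[of "1 - t"] le[of "- (1 - t)"] t by (simp_all add: algebra_simps)
  qed
qed

text \<open>
  The points with \<open>spin_norm u = 1\<close> and \<open>cmod (quad u) = 1\<close> are the extreme points of the closed
  ball, and extreme points are preserved by \<open>T\<close>.
\<close>

lemma isometry_maximal:
  assumes T: "surj_linear_isometry T" and u: "spin_norm u = 1" "cmod (quad u) = 1"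
  shows "cmod (quad (T u)) = 1"
proof (rule ccontr)
  assume *: "cmod (quad (T u)) \<noteq> 1"
  have c: "clinear T" "\<And>x. spin_norm (T x) = spin_norm x" "surj T"
    using T by (simp_all add: surj_linear_isometry_def)
  obtain w where w: "w \<noteq> 0" "spin_norm (T u + w) \<le> 1" "spin_norm (T u - w) \<le> 1"
    using not_extreme_point[of "T u"] u(1) * c(2) by metis
  obtain y where y: "w = T y"
    using c(3) by (metis surjD)
  have "spin_norm (u + y) \<le> 1" "spin_norm (u - y) \<le> 1"
    using w(2,3) unfolding y clinear_add[OF c(1), symmetric] clinear_diff[OF c(1), symmetric] c(2) .
  then have "(norm (u + y))\<^sup>2 \<le> 1" "(norm (u - y))\<^sup>2 \<le> 1"
    by (simp_all add: spin_norm_le_1_iff abs_square_le_1)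
  \<comment> \<open>Parallelogram law: \<open>norm u\<close> is at least one while
    \<open>u + y\<close> and \<open>u - y\<close> have Hilbert norm at most one, which forces
    \<open>y = 0\<close>.\<close>
  moreover have "(norm (u + y))\<^sup>2 + (norm (u - y))\<^sup>2 = 2 * (norm u)\<^sup>2 + 2 * (norm y)\<^sup>2"
    by (simp add: power2_norm_eq_inner inner_add_left inner_add_right inner_diff_left inner_diff_right inner_commute)
  moreover have "1 \<le> (norm u)\<^sup>2"
    using quad_le[of u] u(2) by simp
  ultimately have "(norm y)\<^sup>2 \<le> 0"
    by linarith
  then show False
    using w(1) y clinear_zero[OF c(1)] by simp
qed

lemma isometry_maximal_iff:
  assumes T: "surj_linear_isometry T" and u: "spin_norm u = 1"
  shows "cmod (quad (T u)) = 1 \<longleftrightarrow> cmod (quad u) = 1"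
proof
  assume "cmod (quad (T u)) = 1"
  moreover have "spin_norm (T u) = 1"
    using T u by (simp add: surj_linear_isometry_def)
  ultimately have "cmod (quad (inv T (T u))) = 1"
    using isometry_maximal[OF surj_linear_isometry_inv[OF T]] by blast
  then show "cmod (quad u) = 1"
    using surj_linear_isometry_bij[OF T] by (simp add: bij_is_inj)
qed (rule isometry_maximal[OF T u])

text \<open>A binary quadratic form of modulus one on the real unit circle is a unimodular multiple
  of x^2 + y^2 or of (x \<plusminus> i y)^2. The second kind takes modulus four in \<open>no\<close>
  and is excluded.\<close>

lemma complex_quadratic_form_rigid:
  fixes P R M :: complex
  assumes circle: "\<And>x y :: real. x\<^sup>2 + y\<^sup>2 = 1 \<Longrightarrow>
      cmod ((of_real x)\<^sup>2 * P + 2 * of_real x * of_real y * M + (of_real y)\<^sup>2 * R) = 1"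
    and no: "cmod (P - R + 2 * \<i> * M) \<noteq> 4" "cmod (P - R - 2 * \<i> * M) \<noteq> 4"
  shows "M = 0" and "P = R"
proof -
  \<comment> \<open>\<open>m\<close> is the squared modulus of \<open>M\<close>; \<open>A\<close>,
    \<open>B\<close>, \<open>C\<close> are the real parts of \<open>P * cnj M\<close>,
    \<open>R * cnj M\<close>, \<open>P * cnj R\<close>, and \<open>\<pi>\<close>,
    \<open>\<rho>\<close> the imaginary parts of the first two products.\<close>
  define m where "m = (Re M)\<^sup>2 + (Im M)\<^sup>2"
  define A where "A = Re P * Re M + Im P * Im M"
  define B where "B = Re R * Re M + Im R * Im M"
  define C where "C = Re P * Re R + Im P * Im R"
  define \<pi> where "\<pi> = Im P * Re M - Re P * Im M"
  define \<rho> where "\<rho> = Im R * Re M - Re R * Im M"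
  have P1: "(Re P)\<^sup>2 + (Im P)\<^sup>2 = 1" and R1: "(Re R)\<^sup>2 + (Im R)\<^sup>2 = 1"
    using circle[of 1 0] circle[of 0 1] by (simp_all add: cmod_def)
  have expand: "(x\<^sup>2)\<^sup>2 + (y\<^sup>2)\<^sup>2 + 4 * x\<^sup>2 * y\<^sup>2 * m + 4 * x ^ 3 * y * A + 4 * x * y ^ 3 * B + 2 * x\<^sup>2 * y\<^sup>2 * C = 1"
    if "x\<^sup>2 + y\<^sup>2 = 1" for x y :: real
  proof -
    have "(cmod ((of_real x)\<^sup>2 * P + 2 * of_real x * of_real y * M + (of_real y)\<^sup>2 * R))\<^sup>2
      = (x\<^sup>2)\<^sup>2 * ((Re P)\<^sup>2 + (Im P)\<^sup>2) + (y\<^sup>2)\<^sup>2 * ((Re R)\<^sup>2 + (Im R)\<^sup>2)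
        + 4 * x\<^sup>2 * y\<^sup>2 * m + 4 * x ^ 3 * y * A + 4 * x * y ^ 3 * B + 2 * x\<^sup>2 * y\<^sup>2 * C"
      unfolding cmod_power2 m_def A_def B_def C_def
      by (simp flip: of_real_power add: power2_eq_square power3_eq_cube algebra_simps)
    then show ?thesis
      using circle[OF that] P1 R1 by simp
  qed
  \<comment> \<open>Rational points of the circle turn the quartic relation into linear equations
    for \<open>A\<close>, \<open>B\<close> and \<open>C + 2 * m\<close>.\<close>
  have "A = 0" "B = 0" "C = 1 - 2 * m"
    using expand[of "3/5" "4/5"] expand[of "3/5" "-4/5"] expand[of "4/5" "3/5"] expand[of "4/5" "-3/5"]
    by (simp_all add: power_divide)
  have "\<pi>\<^sup>2 + A\<^sup>2 = ((Re P)\<^sup>2 + (Im P)\<^sup>2) * m" "\<rho>\<^sup>2 + B\<^sup>2 = ((Re R)\<^sup>2 + (Im R)\<^sup>2) * m"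
    "\<pi> * \<rho> + A * B = C * m"
    by (simp_all add: \<pi>_def \<rho>_def A_def B_def C_def m_def power2_eq_square algebra_simps)
  then have \<pi>: "\<pi>\<^sup>2 = m" "\<rho>\<^sup>2 = m" "\<pi> * \<rho> = (1 - 2 * m) * m"
    using P1 R1 \<open>A = 0\<close> \<open>B = 0\<close> \<open>C = 1 - 2 * m\<close> by simp_all
  have "m \<noteq> 1"
  proof
    assume "m = 1"
    then have "\<pi> * \<rho> = - 1" "\<pi>\<^sup>2 = 1"
      using \<pi> by simp_all
    then have \<rho>: "\<rho> = - \<pi>" and "\<pi> = 1 \<or> \<pi> = - 1"
      by (auto simp: power2_eq_1_iff)
    have "P * cnj M = \<i> * of_real \<pi>" "R * cnj M = \<i> * of_real \<rho>"
      using \<open>A = 0\<close> \<open>B = 0\<close> by (simp_all add: complex_eq_iff A_def B_def \<pi>_def \<rho>_def)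
    moreover have M: "cnj M * M = 1"
      using \<open>m = 1\<close> by (simp add: complex_eq_iff m_def power2_eq_square)
    ultimately have "P = \<i> * of_real \<pi> * M" "R = \<i> * of_real \<rho> * M"
      by (metis mult.assoc mult.right_neutral)+
    moreover have "cmod M = 1"
      using \<open>m = 1\<close> by (simp add: cmod_def m_def)
    ultimately show False
      using no \<open>\<pi> = 1 \<or> \<pi> = - 1\<close> \<rho> by (auto simp: norm_mult)
  qed
  moreover have "\<pi> = \<rho> \<or> \<pi> = - \<rho>"
    using \<pi>(1,2) power2_eq_iff[of \<pi> \<rho>] by simp
  then have "\<pi> * \<rho> = m \<or> \<pi> * \<rho> = - m"
    using \<pi>(2) by (auto simp: power2_eq_square)
  then have "m * m = 0 \<or> m * (m - 1) = 0"
    unfolding \<pi>(3) by (auto simp: algebra_simps)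
  ultimately have "m = 0"
    by auto
  then show "M = 0"
    by (simp add: m_def complex_eq_iff sum_power2_eq_zero_iff)
  have "(Re P - Re R)\<^sup>2 + (Im P - Im R)\<^sup>2 = 0"
    using P1 R1 \<open>C = 1 - 2 * m\<close> \<open>m = 0\<close> by (simp add: C_def power2_eq_square algebra_simps)
  then show "P = R"
    by (simp add: complex_eq_iff sum_power2_eq_zero_iff)
qed

text \<open>Real unit combinations of \<open>e\<close> and \<open>f\<close> have spin norm one and
  \<open>quad\<close> equal to one, while (e \<plusminus> i f)/2 have spin norm one and
  \<open>quad\<close> zero. Whether \<open>quad\<close> has modulus one on the unit sphere is
  invariant under \<open>T\<close>, which yields the hypotheses of
  \<open>complex_quadratic_form_rigid\<close>.\<close>

lemma isometry_quad_orthonormal: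
  assumes T: "surj_linear_isometry T"
    and e: "conjn e = e" "norm e = 1" and f: "conjn f = f" "norm f = 1" and ef: "cinner e f = 0"
  shows "cinner (T e) (conjn (T f)) = 0" and "quad (T e) = quad (T f)"
proof -
  define P where "P = quad (T e)"
  define R where "R = quad (T f)"
  define M where "M = cinner (T e) (conjn (T f))"
  have lin: "clinear T"
    using T by (simp add: surj_linear_isometry_def)
  have i: "quad e = 1" "quad f = 1" "cinner e e = 1" "cinner f f = 1" "cinner f e = 0"
    using e f ef by (simp_all add: quad_def cinner_same cinner_commute[of f e])
  have quadT: "quad (T (x *\<^sub>C e + y *\<^sub>C f)) = x\<^sup>2 * P + 2 * x * y * M + y\<^sup>2 * R"
    and quad1: "quad (x *\<^sub>C e + y *\<^sub>C f) = x\<^sup>2 + y\<^sup>2"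
    and norm1: "(norm (x *\<^sub>C e + y *\<^sub>C f))\<^sup>2 = (cmod x)\<^sup>2 + (cmod y)\<^sup>2" for x y
  proof -
    show "quad (T (x *\<^sub>C e + y *\<^sub>C f)) = x\<^sup>2 * P + 2 * x * y * M + y\<^sup>2 * R"
      by (simp add: clinear_add[OF lin] clinear_scaleC[OF lin] quad_add quad_scaleC conjn_simps
          cinner_scaleC_left cinner_scaleC_right P_def M_def R_def)
    show "quad (x *\<^sub>C e + y *\<^sub>C f) = x\<^sup>2 + y\<^sup>2"
      by (simp add: quad_add quad_scaleC conjn_simps cinner_scaleC_left cinner_scaleC_right i f ef)
    have "complex_of_real ((norm (x *\<^sub>C e + y *\<^sub>C f))\<^sup>2) = of_real ((cmod x)\<^sup>2 + (cmod y)\<^sup>2)"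
      unfolding cinner_same[of "x *\<^sub>C e + y *\<^sub>C f", symmetric] of_real_add complex_norm_square
      by (simp add: cinner_simps i ef)
    then show "(norm (x *\<^sub>C e + y *\<^sub>C f))\<^sup>2 = (cmod x)\<^sup>2 + (cmod y)\<^sup>2"
      by (simp only: of_real_eq_iff)
  qed
  have circle: "cmod ((of_real x)\<^sup>2 * P + 2 * of_real x * of_real y * M + (of_real y)\<^sup>2 * R) = 1"
    if "x\<^sup>2 + y\<^sup>2 = 1" for x y :: real
  proof -
    have q: "quad (of_real x *\<^sub>C e + of_real y *\<^sub>C f) = 1"
      using that unfolding quad1 by (metis of_real_1 of_real_add of_real_power)
    moreover have "(norm (of_real x *\<^sub>C e + of_real y *\<^sub>C f))\<^sup>2 = 1"
      using that unfolding norm1 by simp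
    ultimately have "spin_norm (of_real x *\<^sub>C e + of_real y *\<^sub>C f) = 1"
      by (simp add: spin_norm_alt)
    then show ?thesis
      using isometry_maximal[OF T] q by (simp flip: quadT)
  qed
  have no: "cmod (P - R + 2 * s * M) \<noteq> 4" if s: "s = \<i> \<or> s = - \<i>" for s
  proof -
    let ?m = "(1 / 2) *\<^sub>C e + (s / 2) *\<^sub>C f"
    have s2: "s\<^sup>2 = - 1" "cmod s = 1"
      using s by auto
    have q: "quad ?m = 0"
      unfolding quad1 by (simp add: power_divide s2)
    have "(norm ?m)\<^sup>2 = 1 / 2"
      unfolding norm1 by (simp add: s2 norm_divide power_divide)
    then have "spin_norm ?m = 1"
      by (simp only: spin_norm_alt q) (simp add: power_divide real_sqrt_divide)
    then have "cmod (quad (T ?m)) \<noteq> 1"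
      using isometry_maximal_iff[OF T] q by simp
    moreover have "quad (T ?m) = (P - R + 2 * s * M) / 4"
      unfolding quadT by (simp add: power_divide s2 field_simps)
    ultimately show ?thesis
      by (simp add: norm_divide)
  qed
  have "cmod (P - R + 2 * \<i> * M) \<noteq> 4" "cmod (P - R - 2 * \<i> * M) \<noteq> 4"
    using no[of \<i>] no[of "- \<i>"] by simp_all
  then show "M = 0" "P = R"
    using complex_quadratic_form_rigid[of P M R] circle by blast+
qed

section \<open>Invariance of the modulus of the quadratic form\<close>

lemma exists_rotation_real:
  obtains c where "cmod c = 1" "Im (c\<^sup>2 * w) = 0"
proof (cases "w = 0")
  case False
  define c where "c = csqrt (cnj (sgn w))"
  have "c\<^sup>2 * w = of_real (cmod w)"
    using False by (simp add: c_def sgn_div_norm scaleR_conv_of_real field_simps flip: complex_norm_square)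
      (simp add: power2_eq_square flip: complex_norm_square)
  then have "Im (c\<^sup>2 * w) = 0"
    by simp
  moreover have "(cmod c)\<^sup>2 = 1"
    using False by (simp add: c_def norm_sgn flip: norm_power)
  then have "cmod c = 1"
    using norm_ge_zero[of c] by (simp add: power2_eq_1_iff)
  ultimately show ?thesis
    using that by blast
qed (use that[of 1] in simp)

text \<open>A phase makes \<open>quad y\<close> real, so the real and imaginary parts
  \<open>u\<close>, \<open>v\<close> of \<open>y\<close> with respect to \<open>conjn\<close> are
  orthogonal and \<open>quad y\<close> is the difference of their squared norms. The result for
  orthonormal vectors applies to the normalized parts; a vanishing part cannot be normalized and is
  treated apart.\<close>

lemma quad_isometry:
  assumes T: "surj_linear_isometry T"
  shows "cmod (quad (T x)) = cmod (quad x)"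
proof -
  have lin: "clinear T"
    using T by (simp add: surj_linear_isometry_def)
  obtain c where c: "cmod c = 1" "Im (c\<^sup>2 * quad x) = 0"
    by (rule exists_rotation_real)
  define y where "y = c *\<^sub>C x"
  define u where "u = (1 / 2) *\<^sub>C (y + conjn y)"
  define v where "v = (- \<i> / 2) *\<^sub>C (y - conjn y)"
  have u: "conjn u = u" and v: "conjn v = v"
    by (simp_all add: u_def v_def conjn_simps scaleC_add_right scaleC.scale_right_diff_distrib add.commute)
  have y: "y = u + \<i> *\<^sub>C v"
    by (rule cinner_ext) (simp add: u_def v_def cinner_simps field_simps)
  have re: "cinner u v \<in> \<real>"
    using cinner_conjn_conjn[of u v] by (simp add: u v Reals_cnj_iff)
  have quadT: "quad (T (of_real r *\<^sub>C a)) = of_real (r\<^sup>2) * quad (T a)" for a r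
    by (simp add: quad_scaleC clinear_scaleC[OF lin])
  have dir: "\<exists>a. conjn a = a \<and> norm a = 1 \<and> w = of_real (norm w) *\<^sub>C a" if "w \<noteq> 0" "conjn w = w" for w :: 'a
    by (rule exI[of _ "inverse (norm w) *\<^sub>R w"])
      (use that in \<open>simp add: conjn_scaleR scaleR_scaleC[symmetric] scaleR_scaleR\<close>)
  have unit: "cmod (quad (T a)) = 1" if "conjn a = a" "norm a = 1" for a
  proof -
    have q: "quad a = 1"
      using that by (simp add: quad_def cinner_same)
    then have "spin_norm a = 1"
      using that by (simp add: spin_norm_alt)
    then show ?thesis
      using isometry_maximal[OF T] q by simp
  qed
  have quad_y: "quad y = of_real ((norm u)\<^sup>2 - (norm v)\<^sup>2) + 2 * \<i> * cinner u v"
    unfolding y quad_add quad_scaleC conjn_scaleC cinner_scaleC_right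
    by (simp add: quad_def u v cinner_same)
  have "Im (quad y) = 0"
    using c(2) by (simp add: y_def quad_scaleC)
  then have uv: "cinner u v = 0"
    unfolding quad_y using re by (auto simp: complex_eq_iff complex_is_Real_iff)
  have quad_Ty: "quad (T y) = quad (T u) + 2 * (\<i> * cinner (T u) (conjn (T v))) - quad (T v)"
    unfolding y clinear_add[OF lin] clinear_scaleC[OF lin] quad_add quad_scaleC conjn_scaleC cinner_scaleC_right
    by simp
  have "cmod (quad (T y)) = \<bar>(norm u)\<^sup>2 - (norm v)\<^sup>2\<bar>"
  proof (cases "u = 0 \<or> v = 0")
    case True
    have "cmod (quad (T w)) = (norm w)\<^sup>2" if w: "conjn w = w" for w
    proof (cases "w = 0")
      case False
      with dir[OF _ w] obtain a where a: "conjn a = a" "norm a = 1" "w = of_real (norm w) *\<^sub>C a"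
        by blast
      have "quad (T w) = of_real ((norm w)\<^sup>2) * quad (T a)"
        by (subst a(3)) (rule quadT)
      then show ?thesis
        by (simp only: norm_mult unit[OF a(1,2)] norm_of_real) simp
    qed (simp add: clinear_zero[OF lin] quad_def)
    from this[OF u] this[OF v] show ?thesis
      unfolding quad_Ty using True by (auto simp: clinear_zero[OF lin] quad_def)
  next
    case False
    with dir[OF _ u] obtain e where e: "conjn e = e" "norm e = 1" "u = of_real (norm u) *\<^sub>C e"
      by blast
    from False dir[OF _ v] obtain f where f: "conjn f = f" "norm f = 1" "v = of_real (norm v) *\<^sub>C f"
      by blast
    have "of_real (norm u * norm v) * cinner e f = cinner (of_real (norm u) *\<^sub>C e) (of_real (norm v) *\<^sub>C f)"
      by (simp add: cinner_scaleC_left cinner_scaleC_right)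
    then have "of_real (norm u * norm v) * cinner e f = 0"
      unfolding e(3)[symmetric] f(3)[symmetric] uv .
    then have "cinner e f = 0"
      using False by simp
    from isometry_quad_orthonormal[OF T e(1,2) f(1,2) this]
    have ef: "cinner (T e) (conjn (T f)) = 0" "quad (T f) = quad (T e)"
      by simp_all
    have "quad (T u) = of_real ((norm u)\<^sup>2) * quad (T e)"
      by (subst e(3)) (rule quadT)
    moreover have "quad (T v) = of_real ((norm v)\<^sup>2) * quad (T e)"
      unfolding ef(2)[symmetric] by (subst f(3)) (rule quadT)
    moreover have "cinner (T u) (conjn (T v)) = 0"
      by (subst e(3), subst f(3))
        (simp add: clinear_scaleC[OF lin] conjn_scaleC cinner_scaleC_left cinner_scaleC_right ef(1))
    ultimately have "quad (T y) = of_real ((norm u)\<^sup>2 - (norm v)\<^sup>2) * quad (T e)"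
      unfolding quad_Ty by (simp add: algebra_simps)
    then show ?thesis
      by (simp only: norm_mult unit[OF e(1,2)] norm_of_real mult_1_right)
  qed
  then have "cmod (quad (T y)) = cmod (quad y)"
    unfolding quad_y uv by (simp only: norm_of_real mult_zero_right add_0_right)
  moreover have "cmod (quad (T y)) = cmod (quad (T x))" "cmod (quad y) = cmod (quad x)"
    using c(1) by (simp_all add: y_def clinear_scaleC[OF lin] quad_scaleC norm_mult norm_power)
  ultimately show ?thesis
    by simp
qed

section \<open>Weak fixed points\<close>

text \<open>Boundedness in the Hilbert norm follows from
  \<open>norm x \<le> spin_norm x \<le> 2 * norm x\<close>; it lets weak limits pass through
  \<open>T\<close>.\<close>

lemma bounded_clinear_isometry:
  assumes "surj_linear_isometry T"
  shows "bounded_clinear T"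
proof (rule bounded_clinearI)
  show "clinear T"
    using assms by (simp add: surj_linear_isometry_def)
  show "norm (T x) \<le> 2 * norm x" for x
  proof -
    have "sqrt (((norm x)\<^sup>2)\<^sup>2 - (cmod (quad x))\<^sup>2) \<le> (norm x)\<^sup>2"
      by (rule real_le_lsqrt) simp_all
    then have "(norm x)\<^sup>2 + sqrt (((norm x)\<^sup>2)\<^sup>2 - (cmod (quad x))\<^sup>2) \<le> (2 * norm x)\<^sup>2"
      by (simp add: power_mult_distrib) (use zero_le_power2[of "norm x"] in linarith)
    then have "spin_norm x \<le> 2 * norm x"
      unfolding spin_norm_alt by (intro real_le_lsqrt) simp_all
    moreover have "spin_norm (T x) = spin_norm x"
      using assms by (simp add: surj_linear_isometry_def)
    ultimately show ?thesis
      using norm_le_spin_norm[of "T x"] by simp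
  qed
qed

lemma weakly_tendsto_subseq:
  assumes "weakly_tendsto z \<xi>" "strict_mono r"
  shows "weakly_tendsto (z \<circ> r) \<xi>"
  using assms LIMSEQ_subseq_LIMSEQ unfolding weakly_tendsto_def comp_def by blast

lemma spin_ball_quad_less: "x \<in> spin_ball \<Longrightarrow> cmod (quad x) < 1"
  using quad_le[of x] abs_square_less_1[of "norm x"] by (simp add: spin_ball_def spin_norm_less_1_iff)

text \<open>
  The transvection is not weakly continuous, but \<open>quad\<close> is the only ingredient that fails to be;
  so the weak limit of \<open>g (z k)\<close> is determined by the limits of \<open>z k\<close> and of \<open>quad (z k)\<close>.
\<close>

lemma weak_fixed_point_equation:
  fixes \<alpha> :: "nat \<Rightarrow> real"
  assumes T: "surj_linear_isometry T" and a: "a \<in> spin_ball"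
    and z: "\<And>k. z k \<in> spin_ball"
    and fixed: "\<And>k. z k = of_real (\<alpha> k) *\<^sub>C T (transvection a (z k))"
    and \<alpha>: "\<alpha> \<longlonglongrightarrow> 1" and weak: "weakly_tendsto z \<xi>" and quad: "(\<lambda>k. quad (z k)) \<longlonglongrightarrow> \<beta>"
    and d: "1 + 2 * cinner \<xi> a + \<beta> * cnj (quad a) \<noteq> 0"
  shows "\<xi> = T (a + broot a (inverse (1 + 2 * cinner \<xi> a + \<beta> * cnj (quad a)) *\<^sub>C (\<xi> + \<beta> *\<^sub>C conjn a)))"
proof (rule cinner_ext)
  fix w
  define d where "d = 1 + 2 * cinner \<xi> a + \<beta> * cnj (quad a)"
  define F where "F = (\<lambda>x. cinner (T (broot a x)) w)"
  have F: "bounded_clinear F"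
    unfolding F_def
    by (intro bounded_clinear_compose[OF bounded_clinear_cinner]
        bounded_clinear_compose[OF bounded_clinear_isometry[OF T]] bounded_clinear_broot)
  note lin = bounded_clinear_imp_clinear[OF F] clinear_broot bounded_clinear_imp_clinear[OF bounded_clinear_isometry[OF T]]
  have F_eq: "cinner (T (a + broot a (c *\<^sub>C (x + b *\<^sub>C conjn a)))) w
      = cinner (T a) w + c * (F x + b * F (conjn a))" for c b x
    unfolding F_def by (simp add: lin(2,3)[THEN clinear_add] lin(2,3)[THEN clinear_scaleC] cinner_simps algebra_simps)
  have z_eq: "cinner (z k) w = of_real (\<alpha> k) * (cinner (T a) w
      + inverse (qdenom a (z k)) * (F (z k) + quad (z k) * F (conjn a)))" for k
  proof -
    have "spin_norm (z k) \<le> 1"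
      using z[of k] by (simp add: spin_ball_def)
    then show ?thesis
      by (subst fixed) (simp only: cinner_scaleC_left transvection_eq_root[OF a] F_eq)
  qed
  have lims: "(\<lambda>k. F (z k)) \<longlonglongrightarrow> F \<xi>" "(\<lambda>k. cinner (z k) a) \<longlonglongrightarrow> cinner \<xi> a"
    using weak F weakly_tendsto_cinner by (auto simp: weakly_tendsto_def)
  have "(\<lambda>k. qdenom a (z k)) \<longlonglongrightarrow> d"
    unfolding qdenom_def d_def by (intro tendsto_intros lims quad)
  then have "(\<lambda>k. cinner (z k) w) \<longlonglongrightarrow> of_real 1 * (cinner (T a) w + inverse d * (F \<xi> + \<beta> * F (conjn a)))"
    unfolding z_eq using d by (intro tendsto_intros lims quad \<alpha>) (simp_all add: d_def)
  from LIMSEQ_unique[OF weakly_tendsto_cinner[OF weak] this]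
  show "cinner \<xi> w = cinner (T (a + broot a (inverse (1 + 2 * cinner \<xi> a + \<beta> * cnj (quad a)) *\<^sub>C (\<xi> + \<beta> *\<^sub>C conjn a)))) w"
    unfolding F_eq d_def by simp
qed

lemma fixed_point_if_quad_tendsto:
  fixes \<alpha> :: "nat \<Rightarrow> real"
  assumes "surj_linear_isometry T" "a \<in> spin_ball" "\<And>k. z k \<in> spin_ball"
    and "\<And>k. z k = of_real (\<alpha> k) *\<^sub>C T (transvection a (z k))"
    and "\<alpha> \<longlonglongrightarrow> 1" "weakly_tendsto z \<xi>" "(\<lambda>k. quad (z k)) \<longlonglongrightarrow> quad \<xi>"
    and \<xi>: "spin_norm \<xi> \<le> 1"
  shows "T (transvection a \<xi>) = \<xi>"
proof -
  have "1 + 2 * cinner \<xi> a + quad \<xi> * cnj (quad a) \<noteq> 0"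
    using qdenom_nonzero[OF assms(2) \<xi>] by (simp add: qdenom_def)
  from weak_fixed_point_equation[OF assms(1-7) this] show ?thesis
    unfolding transvection_eq_root[OF assms(2) \<xi>] qdenom_def by (rule sym)
qed

text \<open>
  Weak convergence in the ball to a point of norm one makes \<open>z k\<close> converge in norm, since in the
  estimate below \<open>u\<^sup>2\<close> with \<open>u = (norm (z k - \<xi>))\<^sup>2\<close> is bounded by a null sequence.
\<close>

lemma quad_tendsto_sphere:
  assumes z: "\<And>k. z k \<in> spin_ball" and weak: "weakly_tendsto z \<xi>" and \<xi>: "spin_norm \<xi> = 1"
  shows "(\<lambda>k. quad (z k)) \<longlonglongrightarrow> quad \<xi>"
proof -
  define u where "u = (\<lambda>k. (norm (z k - \<xi>))\<^sup>2)"
  define \<epsilon> where "\<epsilon> = (\<lambda>k. 4 * cmod (cinner (z k - \<xi>) \<xi>))"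
  define \<zeta> where "\<zeta> = (\<lambda>k. 2 * cmod (cinner (z k - \<xi>) (conjn \<xi>)))"
  define t where "t = cmod (quad \<xi>)"
  define h where "h = (norm \<xi>)\<^sup>2"
  have h: "2 * h = 1 + t\<^sup>2"
    using spin_norm_eq_1_det[OF \<xi>] by (simp add: spin_det_def h_def t_def)
  have n1: "norm \<xi> \<le> 1"
    using \<xi> spin_norm_le_1_iff[of \<xi>] by simp
  then have "h \<le> 1"
    by (simp add: h_def abs_square_le_1)
  then have t: "0 \<le> t" "t \<le> 1"
    using quad_le[of \<xi>] by (simp_all add: t_def h_def)
  have lim0: "(\<lambda>k. cinner (z k - \<xi>) y) \<longlonglongrightarrow> 0" for y
    using tendsto_diff[OF weakly_tendsto_cinner[OF weak, of y] tendsto_const[of "cinner \<xi> y"]]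
    by (simp add: cinner_diff_left)
  have \<epsilon>: "\<epsilon> \<longlonglongrightarrow> 0"
    unfolding \<epsilon>_def by (rule tendsto_eq_intros lim0 refl | simp)+
  have \<zeta>: "\<zeta> \<longlonglongrightarrow> 0"
    unfolding \<zeta>_def by (rule tendsto_eq_intros lim0 refl | simp)+
  have quad_z: "quad (z k) = quad \<xi> + 2 * cinner (z k - \<xi>) (conjn \<xi>) + quad (z k - \<xi>)" for k
    using quad_add[of "\<xi>" "z k - \<xi>"] by (simp add: cinner_conjn_right[of \<xi>])
  \<comment> \<open>The constants come from \<open>t \<le> 1\<close> and \<open>u k \<le> 4\<close>:
    10 is 2 * (1 + 4), and 9 is 1 + 2 * 4.\<close>
  have bound: "(u k)\<^sup>2 \<le> 9 * \<epsilon> k + \<zeta> k * (10 + \<zeta> k)" for k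
  proof -
    have zk: "norm (z k) \<le> 1" "0 \<le> spin_det (z k)"
      using z[of k] by (simp_all add: spin_ball_def spin_norm_less_1_iff)
    have u: "0 \<le> u k" "u k \<le> 4"
    proof -
      have "norm (z k - \<xi>) \<le> 2"
        using norm_triangle_ineq4[of "z k" \<xi>] zk n1 by linarith
      then show "u k \<le> 4"
        using power_mono[of "norm (z k - \<xi>)" 2 2] by (simp add: u_def)
    qed (simp add: u_def)
    have e0: "0 \<le> \<epsilon> k" "0 \<le> \<zeta> k"
      by (simp_all add: \<epsilon>_def \<zeta>_def)
    have "(norm (z k))\<^sup>2 = h + u k + 2 * Re (cinner (z k - \<xi>) \<xi>)"
      unfolding h_def u_def inner_eq_Re_cinner[symmetric] power2_norm_eq_inner
      by (simp add: inner_diff_left inner_diff_right inner_commute)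
    then have nz: "h + u k - \<epsilon> k / 2 \<le> (norm (z k))\<^sup>2"
      using abs_Re_le_cmod[of "cinner (z k - \<xi>) \<xi>"] by (simp add: \<epsilon>_def)
    have "cmod (quad (z k)) \<le> (t + u k) + \<zeta> k"
      unfolding quad_z[of k] t_def \<zeta>_def u_def
      using quad_le[of "z k - \<xi>"] norm_triangle_ineq[of "quad \<xi> + 2 * cinner (z k - \<xi>) (conjn \<xi>)" "quad (z k - \<xi>)"]
        norm_triangle_ineq[of "quad \<xi>" "2 * cinner (z k - \<xi>) (conjn \<xi>)"]
      by (simp add: norm_mult)
    then have "(cmod (quad (z k)))\<^sup>2 \<le> ((t + u k) + \<zeta> k)\<^sup>2"
      by (intro power_mono) simp_all
    also have "\<dots> = (t + u k)\<^sup>2 + \<zeta> k * (2 * (t + u k) + \<zeta> k)"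
      by (simp add: power2_eq_square algebra_simps)
    also have "\<dots> \<le> (t + u k)\<^sup>2 + \<zeta> k * (10 + \<zeta> k)"
      using e0 u t by (intro add_left_mono mult_left_mono) auto
    finally have "0 \<le> 1 - 2 * (h + u k - \<epsilon> k / 2) + (t + u k)\<^sup>2 + \<zeta> k * (10 + \<zeta> k)"
      by - (rule order_trans[OF zk(2)], unfold spin_det_def, use nz in argo)
    then have 1: "2 * (u k * (1 - t)) - (u k)\<^sup>2 \<le> \<epsilon> k + \<zeta> k * (10 + \<zeta> k)"
      using h by (simp add: power2_eq_square algebra_simps)
    have "(norm (z k))\<^sup>2 \<le> 1"
      using zk(1) by (simp add: abs_square_le_1)
    moreover have "0 \<le> (1 - t)\<^sup>2"
      by simp
    then have "2 * (1 - h) \<le> 2 * (1 - t)"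
      using h t by (simp add: power2_diff)
    ultimately have "u k \<le> (1 - t) + \<epsilon> k"
      using nz e0 by argo
    \<comment> \<open>Nonnegativity of \<open>spin_det (z k)\<close> bounds
      \<open>2 * u k * (1 - t)\<close> by \<open>(u k)\<^sup>2\<close> up to errors, while
      \<open>norm (z k) \<le> 1\<close> bounds \<open>u k\<close> by \<open>1 - t\<close> up to
      errors. Twice the inequality formed here, combined with the first bound, leaves only error
      terms above \<open>(u k)\<^sup>2\<close>.\<close>
    then have "u k * u k \<le> u k * ((1 - t) + \<epsilon> k)"
      using u by (intro mult_left_mono)
    also have "\<dots> \<le> u k * (1 - t) + 4 * \<epsilon> k"
      using mult_right_mono[OF u(2) e0(1)] by (simp add: algebra_simps)
    finally show ?thesis
      using 1 by (simp add: power2_eq_square)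
  qed
  have "(\<lambda>k. 9 * \<epsilon> k + \<zeta> k * (10 + \<zeta> k)) \<longlonglongrightarrow> 0"
    by (rule tendsto_eq_intros \<epsilon> \<zeta> refl | simp)+
  then have "(\<lambda>k. (u k)\<^sup>2) \<longlonglongrightarrow> 0"
    by (rule tendsto_sandwich[OF _ _ tendsto_const, rotated 2]) (simp_all add: bound)
  then have "(\<lambda>k. sqrt ((u k)\<^sup>2)) \<longlonglongrightarrow> sqrt 0"
    by (rule tendsto_real_sqrt)
  moreover have "sqrt ((u k)\<^sup>2) = u k" for k
    unfolding real_sqrt_abs by (simp add: u_def)
  ultimately have "u \<longlonglongrightarrow> 0"
    by (simp only: real_sqrt_zero)
  then have "(\<lambda>k. quad (z k - \<xi>)) \<longlonglongrightarrow> 0"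
    by (rule Lim_null_comparison[rotated]) (simp add: u_def quad_le)
  then have "(\<lambda>k. quad \<xi> + 2 * cinner (z k - \<xi>) (conjn \<xi>) + quad (z k - \<xi>)) \<longlonglongrightarrow> quad \<xi> + 2 * 0 + 0"
    by (intro tendsto_intros lim0)
  then show ?thesis
    by (simp flip: quad_z)
qed

section \<open>Weakly null sequences and sequences of isotropic points\<close>

lemma weakly_null_case:
  fixes \<alpha> :: "nat \<Rightarrow> real"
  assumes T: "surj_linear_isometry T" and a: "a \<in> spin_ball" and "a \<noteq> 0"
    and z: "\<And>k. z k \<in> spin_ball"
    and fixed: "\<And>k. z k = of_real (\<alpha> k) *\<^sub>C T (transvection a (z k))"
    and \<alpha>: "\<alpha> \<longlonglongrightarrow> 1" and weak: "weakly_tendsto z 0" and quad: "(\<lambda>k. quad (z k)) \<longlonglongrightarrow> \<beta>"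
  shows "a = - (\<beta> *\<^sub>C conjn a)" and "cmod \<beta> = 1"
proof -
  have "cmod (quad (z k)) \<le> 1" for k
    using spin_ball_quad_less[OF z] by (rule less_imp_le)
  then have "cmod \<beta> \<le> 1"
    using LIMSEQ_le_const2[OF tendsto_norm[OF quad], of 1] by blast
  then have "cmod (\<beta> * cnj (quad a)) < 1"
    using spin_ball_quad_less[OF a] mult_right_mono[of "cmod \<beta>" 1 "cmod (quad a)"] by (simp add: norm_mult)
  then have nz: "1 + \<beta> * cnj (quad a) \<noteq> 0"
    by (metis add_eq_0_iff less_irrefl norm_minus_cancel norm_one)
  define d where "d = 1 + \<beta> * cnj (quad a)"
  have lin: "clinear T"
    using T by (simp add: surj_linear_isometry_def)
  have "0 = T (a + broot a (inverse d *\<^sub>C (\<beta> *\<^sub>C conjn a)))"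
    using weak_fixed_point_equation[OF T a z fixed \<alpha> weak quad] nz by (simp add: d_def)
  then have "T (a + broot a (inverse d *\<^sub>C (\<beta> *\<^sub>C conjn a))) = T 0"
    by (simp add: clinear_zero[OF lin])
  then have "a + broot a (inverse d *\<^sub>C (\<beta> *\<^sub>C conjn a)) = 0"
    using surj_linear_isometry_bij[OF T] by (simp add: bij_is_inj inj_eq)
  \<comment> \<open>After multiplication by \<open>d\<close> the terms containing
    \<open>cnj (quad a)\<close> cancel.\<close>
  then have eq: "a + (inverse d * \<beta>) *\<^sub>C (conjn a - cnj (quad a) *\<^sub>C a) = 0"
    by (simp add: clinear_scaleC[OF clinear_broot] broot_conjn[OF a] scaleC_scaleC)
  show *: "a = - (\<beta> *\<^sub>C conjn a)"
  proof (rule cinner_ext)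
    fix w
    have "cinner a w + inverse d * \<beta> * (cinner (conjn a) w - cnj (quad a) * cinner a w) = 0"
      using arg_cong[OF eq, of "\<lambda>v. cinner v w"] by (simp add: cinner_simps)
    then have "d * cinner a w + \<beta> * (cinner (conjn a) w - cnj (quad a) * cinner a w) = 0"
      using nz by (simp add: d_def[symmetric] field_simps)
    then have "cinner a w = - (\<beta> * cinner (conjn a) w)"
      unfolding d_def by (simp add: algebra_simps add_eq_0_iff)
    then show "cinner a w = cinner (- (\<beta> *\<^sub>C conjn a)) w"
      by (simp add: cinner_simps)
  qed
  have "norm a = cmod \<beta> * norm a"
    using arg_cong[OF *, of norm] by (simp add: norm_scaleC norm_conjn)
  then show "cmod \<beta> = 1"
    using \<open>a \<noteq> 0\<close> by simp
qed

lemma maximal_tripotentI: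
  assumes "a \<noteq> 0" "conjn a = \<mu> *\<^sub>C a" "cmod \<mu> = 1"
  shows "maximal_tripotent (of_real (inverse (norm a)) *\<^sub>C a)"
proof -
  define e where "e = of_real (inverse (norm a)) *\<^sub>C a"
  have "norm e = 1"
    using assms(1) by (simp add: e_def norm_scaleC norm_inverse)
  then have e: "e \<noteq> 0" "cinner e e = 1"
    by (auto simp: cinner_same)
  have je: "conjn e = \<mu> *\<^sub>C e"
    by (simp add: e_def conjn_scaleC assms(2) scaleC_scaleC mult.commute)
  have "cnj \<mu> * \<mu> = 1"
    using assms(3) by (simp add: mult.commute flip: complex_norm_square)
  then have "triple e e e = e"
    by (simp add: triple_def e je cinner_scaleC_right scaleC_scaleC)
  then have "maximal_tripotent e"
    using e je assms(3) by (auto simp: maximal_tripotent_def tripotent_def)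
  then show ?thesis
    by (simp only: e_def)
qed

lemma isotropic_case:
  fixes \<alpha> :: "nat \<Rightarrow> real"
  assumes T: "surj_linear_isometry T" and a: "a \<in> spin_ball"
    and \<alpha>: "\<And>k. 0 < \<alpha> k \<and> \<alpha> k < 1"
    and z: "\<And>k. z k \<in> spin_ball"
    and fixed: "\<And>k. z k = of_real (\<alpha> k) *\<^sub>C T (transvection a (z k))"
    and weak: "weakly_tendsto z \<xi>" and isotropic: "\<And>k. quad (z k) = 0"
  shows "quad \<xi> = 0" and "spin_norm \<xi> \<le> 1"
proof -
  have lin: "clinear T"
    using T by (simp add: surj_linear_isometry_def)
  have zk: "spin_norm (z k) \<le> 1" "0 < spin_det (z k)" for k
    using z[of k] spin_norm_less_1_iff[of "z k"] by (simp_all add: spin_ball_def)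
  have Tg: "T (transvection a (z k)) = of_real (inverse (\<alpha> k)) *\<^sub>C z k" for k
  proof -
    have "of_real (inverse (\<alpha> k)) *\<^sub>C z k = of_real (inverse (\<alpha> k)) *\<^sub>C of_real (\<alpha> k) *\<^sub>C T (transvection a (z k))"
      by (subst fixed) (rule refl)
    also have "\<dots> = T (transvection a (z k))"
      using \<alpha>[of k] by (simp add: scaleC_scaleC)
    finally show ?thesis by simp
  qed
  have spin_norm_isotropic: "(spin_norm y)\<^sup>2 = 2 * (norm y)\<^sup>2" if "quad y = 0" for y :: 'a
    unfolding spin_norm_alt that
    by (simp only: norm_zero power_zero_numeral diff_0_right real_sqrt_abs abs_power2) simp
  have denom: "spin_det a \<le> (cmod (qdenom a (z k)))\<^sup>2" for k
  proof -
    define y where "y = transvection a (z k)"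
    have "cmod (quad y) = cmod (quad (T y))"
      by (rule quad_isometry[OF T, symmetric])
    then have y: "quad y = 0"
      by (simp add: y_def Tg quad_scaleC isotropic)
    \<comment> \<open>As \<open>\<alpha> k < 1\<close>, the image \<open>y\<close> is at least as
      large as \<open>z k\<close>. For isotropic vectors the determinant decreases with the
      norm.\<close>
    have "spin_norm y = spin_norm (T y)"
      using T by (simp add: surj_linear_isometry_def)
    also have "\<dots> = inverse (\<alpha> k) * spin_norm (z k)"
      using \<alpha>[of k] by (simp add: y_def Tg spin_norm_scaleC norm_inverse)
    also have "\<dots> \<ge> 1 * spin_norm (z k)"
      using \<alpha>[of k] by (intro mult_right_mono spin_norm_nonneg) (simp add: one_le_inverse)
    finally have "(spin_norm (z k))\<^sup>2 \<le> (spin_norm y)\<^sup>2"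
      by (intro power_mono) (simp_all add: spin_norm_nonneg)
    then have le: "spin_det y \<le> spin_det (z k)"
      using spin_norm_isotropic[OF y] spin_norm_isotropic[OF isotropic[of k]]
      by (simp add: spin_det_def y isotropic)
    have eq: "spin_det y * (cmod (qdenom a (z k)))\<^sup>2 = spin_det a * spin_det (z k)"
      unfolding y_def by (rule spin_det_transvection[OF a zk(1)])
    moreover have "0 < spin_det a * spin_det (z k)"
      using spin_det_pos[OF a] zk(2)[of k] by simp
    ultimately have pos: "0 < spin_det y"
      by (metis mult_less_0_iff not_less zero_le_power2 zero_less_mult_iff)
    have "spin_det y * spin_det a \<le> spin_det y * (cmod (qdenom a (z k)))\<^sup>2"
      unfolding eq using mult_left_mono[OF le less_imp_le[OF spin_det_pos[OF a]]] by (simp add: mult.commute)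
    then show ?thesis
      using pos by simp
  qed
  have orth: "cinner (z k) (conjn (z l)) = 0" for k l
  proof (rule ccontr)
    let ?c = "cinner (z k) (conjn (z l))" and ?d = "cmod (qdenom a (z k)) * cmod (qdenom a (z l))"
    assume c: "?c \<noteq> 0"
    have "cmod (quad (transvection a (z k) - transvection a (z l)))
        = cmod (quad (T (transvection a (z k)) - T (transvection a (z l))))"
      using quad_isometry[OF T] by (metis clinear_diff[OF lin])
    also have "\<dots> = inverse (\<alpha> k) * inverse (\<alpha> l) * (2 * cmod ?c)"
      unfolding Tg quad_diff quad_scaleC isotropic conjn_scaleC cinner_scaleC_left cinner_scaleC_right
      using \<alpha>[of k] \<alpha>[of l] by (simp add: norm_mult norm_inverse)
    finally have "inverse (\<alpha> k) * inverse (\<alpha> l) * (2 * cmod ?c) = spin_det a * (2 * cmod ?c) / ?d"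
      unfolding quad_transvection_diff[OF a zk(1) zk(1)] quad_diff[of "z k" "z l"] isotropic
      using spin_det_pos[OF a] by (simp add: norm_mult norm_divide)
    then have "?d = \<alpha> k * \<alpha> l * spin_det a"
      using c \<alpha>[of k] \<alpha>[of l] qdenom_nonzero[OF a zk(1), of k] qdenom_nonzero[OF a zk(1), of l]
      by (simp add: field_simps)
    moreover have "\<alpha> k * \<alpha> l < 1"
      using \<alpha>[of k] \<alpha>[of l] by (simp add: mult_strict_mono[of "\<alpha> k" 1 "\<alpha> l" 1, simplified])
    ultimately have "?d < spin_det a"
      using spin_det_pos[OF a] by simp
    moreover have "(spin_det a)\<^sup>2 \<le> ?d\<^sup>2"
      using mult_mono[OF denom[of k] denom[of l]] spin_det_pos[OF a] by (simp add: power2_eq_square ac_simps)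
    then have "spin_det a \<le> ?d"
      by (rule power2_le_imp_le) simp
    ultimately show False
      by simp
  qed
  \<comment> \<open>The weak limit is taken in one index with the other fixed, and afterwards in the
    other.\<close>
  have "cinner \<xi> (conjn (z k)) = 0" for k
    using weakly_tendsto_cinner[OF weak, of "conjn (z k)"] by (simp add: orth LIMSEQ_const_iff)
  then have "cinner (z k) (conjn \<xi>) = 0" for k
    by (simp add: cinner_conjn_right[of "z k"])
  then show quad0: "quad \<xi> = 0"
    using weakly_tendsto_cinner[OF weak, of "conjn \<xi>"] by (simp add: quad_def LIMSEQ_const_iff)
  \<comment> \<open>For isotropic vectors the unit ball is the Hilbert ball of radius
    \<open>sqrt (1 / 2)\<close>; the bound passes to the weak limit by pairing with
    \<open>\<xi>\<close>.\<close>
  have "norm (z k) \<le> sqrt (1 / 2)" for k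
    using zk(2)[of k] by (intro real_le_rsqrt) (simp add: spin_det_def isotropic)
  then have "cmod (cinner (z k) \<xi>) \<le> sqrt (1 / 2) * norm \<xi>" for k
    using cinner_Cauchy_Schwarz[of "z k" \<xi>] mult_right_mono[of "norm (z k)" "sqrt (1/2)" "norm \<xi>"]
    by (meson norm_ge_zero order_trans)
  then have "cmod (cinner \<xi> \<xi>) \<le> sqrt (1 / 2) * norm \<xi>"
    using LIMSEQ_le_const2[OF tendsto_norm[OF weakly_tendsto_cinner[OF weak, of \<xi>]]] by blast
  then have "norm \<xi> * norm \<xi> \<le> sqrt (1 / 2) * norm \<xi>"
    by (simp add: cinner_same norm_power power2_eq_square norm_mult)
  then have n: "norm \<xi> \<le> sqrt (1 / 2)"
    by (cases "\<xi> = 0") simp_all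
  then have "(norm \<xi>)\<^sup>2 \<le> (sqrt (1 / 2))\<^sup>2"
    by (intro power_mono) simp_all
  then have "(norm \<xi>)\<^sup>2 \<le> 1 / 2"
    by simp
  moreover from this have "norm \<xi> \<le> 1"
    by (intro power2_le_imp_le[of "norm \<xi>" 1]) simp_all
  ultimately show "spin_norm \<xi> \<le> 1"
    unfolding spin_norm_le_1_iff by (simp add: spin_det_def quad0)
qed

section \<open>Reduction of the four conditions to limits of the quadratic form\<close>

theorem theorem4p4:
  fixes g T :: "'a::spin_factor \<Rightarrow> 'a"
    and a \<xi> :: 'a
    and \<alpha> :: "nat \<Rightarrow> real"
    and z :: "nat \<Rightarrow> 'a"
  assumes "biholomorphic_automorphism spin_ball g"
    and "surj_linear_isometry T"
    and "a \<in> spin_ball"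
    and "g = T \<circ> transvection a"
    and "\<xi> \<in> closure spin_ball"
    and "\<And>k. 0 < \<alpha> k \<and> \<alpha> k < 1"
    and "incseq \<alpha>" and "\<alpha> \<longlonglongrightarrow> 1"
    and "\<And>k. z k \<in> spin_ball"
    and "\<And>k. z k = complex_of_real (\<alpha> k) *\<^sub>C g (z k)"
    and "weakly_tendsto z \<xi>"
    and "spin_norm \<xi> = 1
      \<or> \<xi> = 0 \<and> \<not> (\<exists>c e. c \<noteq> 0 \<and> maximal_tripotent e \<and> a = c *\<^sub>C e)
      \<or> \<xi> = 0 \<and> \<not> (\<lambda>k. spin_norm (z k)) \<longlonglongrightarrow> 1
      \<or> (\<forall>k. rank_one (z k))"
  shows "g \<xi> = \<xi>"
proof -
  note T = assms(2) and a = assms(3) and z = assms(9) and weak = assms(11)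
  have fixed: "z k = of_real (\<alpha> k) *\<^sub>C T (transvection a (z k))" for k
    using assms(10)[of k] by (simp add: assms(4))
  have g: "g \<xi> = T (transvection a \<xi>)"
    by (simp add: assms(4))
  have lin: "clinear T"
    using T by (simp add: surj_linear_isometry_def)
  have subseq: "\<exists>s \<beta>. strict_mono s \<and> (\<lambda>k. quad (z (r (s k)))) \<longlonglongrightarrow> \<beta>" for r :: "nat \<Rightarrow> nat"
  proof -
    have "bounded (range (\<lambda>k. quad (z (r k))))"
      unfolding bounded_iff using spin_ball_quad_less[OF z] by (intro exI[of _ 1]) (auto intro: less_imp_le)
    from bounded_imp_convergent_subsequence[OF this] show ?thesis
      by (auto simp: o_def)
  qed
  have null: "a = - (\<beta> *\<^sub>C conjn a)" "cmod \<beta> = 1"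
    if "\<xi> = 0" "a \<noteq> 0" "strict_mono r" "(\<lambda>k. quad (z (r k))) \<longlonglongrightarrow> \<beta>" for r \<beta>
  proof -
    have w: "weakly_tendsto (z \<circ> r) 0"
      using weakly_tendsto_subseq[OF weak that(3)] that(1) by simp
    have al: "(\<alpha> \<circ> r) \<longlonglongrightarrow> 1"
      by (rule LIMSEQ_subseq_LIMSEQ[OF assms(8) that(3)])
    note * = weakly_null_case[OF T a that(2) _ _ al w, of \<beta>]
    show "a = - (\<beta> *\<^sub>C conjn a)" "cmod \<beta> = 1"
      using * z fixed that(4) by (simp_all add: o_def)
  qed
  have zero: "g \<xi> = \<xi>" if "\<xi> = 0" "a = 0"
    unfolding g unfolding that using transvection_eq_root[OF a, of 0]
    by (simp add: that spin_norm_alt quad_def clinear_zero[OF lin] clinear_zero[OF clinear_broot])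
  \<comment> \<open>For \<open>a = 0\<close> the origin is fixed directly. With
    \<open>\<xi> = 0\<close> and \<open>a \<noteq> 0\<close> the second and third conditions turn
    out to be contradictory.\<close>
  consider "spin_norm \<xi> = 1"
    | "\<xi> = 0" "a = 0"
    | "\<xi> = 0" "a \<noteq> 0" "\<not> (\<exists>c e. c \<noteq> 0 \<and> maximal_tripotent e \<and> a = c *\<^sub>C e)"
    | "\<xi> = 0" "a \<noteq> 0" "\<not> (\<lambda>k. spin_norm (z k)) \<longlonglongrightarrow> 1"
    | "\<And>k. rank_one (z k)"
    using assms(12) by blast
  then show ?thesis
  proof cases
    case 1
    then show ?thesis
      unfolding g by (intro fixed_point_if_quad_tendsto[OF T a z fixed assms(8) weak] quad_tendsto_sphere[OF z weak]) simp_all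
  next
    case 2
    then show ?thesis
      by (rule zero)
  next
    case 3
    from subseq[of "\<lambda>k. k"] obtain s \<beta> where s: "strict_mono s" "(\<lambda>k. quad (z (s k))) \<longlonglongrightarrow> \<beta>"
      by blast
    note \<beta> = null[OF 3(1,2) s]
    \<comment> \<open>Multiplication by \<open>cnj \<beta>\<close> solves the relation for
      \<open>conjn a\<close>, so the normalized \<open>a\<close> is a maximal tripotent.\<close>
    have "cnj \<beta> *\<^sub>C a = - ((cnj \<beta> * \<beta>) *\<^sub>C conjn a)"
      using arg_cong[OF \<beta>(1), of "\<lambda>v. cnj \<beta> *\<^sub>C v"] by (simp only: scaleC.scale_minus_right scaleC_scaleC)
    moreover have "cnj \<beta> * \<beta> = 1"
      using \<beta>(2) by (simp add: mult.commute flip: complex_norm_square)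
    ultimately have "conjn a = (- cnj \<beta>) *\<^sub>C a"
      by simp
    from maximal_tripotentI[OF 3(2) this] \<beta>(2)
    have "maximal_tripotent (of_real (inverse (norm a)) *\<^sub>C a)"
      by simp
    moreover have "a = of_real (norm a) *\<^sub>C of_real (inverse (norm a)) *\<^sub>C a"
      using 3(2) by (simp add: scaleC_scaleC)
    ultimately have False
      using 3(2,3) by (metis norm_eq_zero of_real_eq_0_iff)
    then show ?thesis ..
  next
    case 4
    \<comment> \<open>A subsequence keeps \<open>spin_norm\<close> away from one. Along a further
      subsequence \<open>quad\<close> converges to a unimodular limit, and
      \<open>cmod (quad (z k)) \<le> spin_norm (z k) \<le> 1\<close> squeezes
      \<open>spin_norm\<close> to one.\<close>
    then obtain \<epsilon> where "0 < \<epsilon>" "\<forall>N. \<exists>n\<ge>N. \<not> dist (spin_norm (z n)) 1 < \<epsilon>"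
      unfolding lim_sequentially by blast
    then have "infinite {n. \<not> dist (spin_norm (z n)) 1 < \<epsilon>}"
      by (auto simp: infinite_nat_iff_unbounded_le)
    from infinite_enumerate[OF this] obtain r :: "nat \<Rightarrow> nat" where
      r: "strict_mono r" "\<forall>n. r n \<in> {n. \<not> dist (spin_norm (z n)) 1 < \<epsilon>}"
      by blast
    from subseq[of r] obtain s \<beta> where s: "strict_mono s" "(\<lambda>k. quad (z (r (s k)))) \<longlonglongrightarrow> \<beta>"
      by blast
    have "cmod \<beta> = 1"
      using null(2)[OF 4(1,2) strict_mono_o[OF r(1) s(1)]] s(2) by simp
    then have lim: "(\<lambda>k. cmod (quad (z (r (s k))))) \<longlonglongrightarrow> 1"
      using tendsto_norm[OF s(2)] by simp
    have le: "cmod (quad (z k)) \<le> spin_norm (z k)" "spin_norm (z k) \<le> 1" for k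
    proof -
      show "spin_norm (z k) \<le> 1"
        using z[of k] by (simp add: spin_ball_def)
      then have "norm (z k) * norm (z k) \<le> spin_norm (z k) * 1"
        using norm_le_spin_norm[of "z k"] by (intro mult_mono) (auto simp: spin_norm_nonneg)
      then show "cmod (quad (z k)) \<le> spin_norm (z k)"
        using quad_le[of "z k"] by (simp add: power2_eq_square)
    qed
    have "(\<lambda>k. spin_norm (z (r (s k)))) \<longlonglongrightarrow> 1"
      by (rule tendsto_sandwich[OF _ _ lim tendsto_const]) (simp_all add: le)
    with \<open>0 < \<epsilon>\<close> obtain k where "dist (spin_norm (z (r (s k)))) 1 < \<epsilon>"
      unfolding lim_sequentially by blast
    with r(2) show ?thesis
      by blast
  next
    case 5
    have iso: "quad (z k) = 0" for k
    proof -
      obtain c e where "quad e = 0" "z k = c *\<^sub>C e"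
        using 5[of k] by (auto simp: rank_one_def minimal_tripotent_def quad_def)
      then show ?thesis
        by (simp add: quad_scaleC)
    qed
    note \<xi> = isotropic_case[OF T a assms(6) z fixed weak iso]
    show ?thesis
      unfolding g by (rule fixed_point_if_quad_tendsto[OF T a z fixed assms(8) weak _ \<xi>(2)]) (simp add: iso \<xi>(1))
  qed
qed

end
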